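(* Let $\Omega=(a,b)$ be a bounded interval, let $K(\rho)=\rho/(1+\rho)$ for $\rho\ge0$, and let $g(x)=x$. Then for some fidelity parameter $\lambda>0$ there exist two minimizers of $TV_{Kg}$ over $BV(a,b)$: one is a piecewise constant function with only one jump and the other is a piecewise constant function with two jumps.
   Context: For $u\in BV(\Omega)$, $\Omega=(a,b)$, with distributional derivative $Du$, jump set $J_u$ and one-sided limits $u^\pm$ at points of $J_u$, set $$TV_K(u)=\int_{\Omega\setminus J_u}|Du|+\sum_{x\in J_u}K(|u^+(x)-u^-(x)|),\qquad TV_{Kg}(u)=TV_K(u)+\frac{\lambda}{2}\int_\Omega|u-g|^2\,dx,$$ where $\lambda>0$ is called the fidelity parameter. *)

theory Defs
  imports "HOL-Analysis.Analysis" "HOL-Library.Disjoint_Sets"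
begin

text \<open>
  Elements of \<open>BV(a,b)\<close> are represented by functions \<open>real \<Rightarrow> real\<close>.  Everything below
  except \<open>piecewise_constant\<close> depends only on the class of the function modulo equality
  almost everywhere on \<open>(a,b)\<close>.
\<close>

definition test_function :: "real \<Rightarrow> real \<Rightarrow> (real \<Rightarrow> real) \<Rightarrow> bool" where
  "test_function a b \<phi> \<longleftrightarrow>
     (\<forall>n. (deriv ^^ n) \<phi> differentiable_on UNIV) \<and>
     compact (closure {x. \<phi> x \<noteq> 0}) \<and> closure {x. \<phi> x \<noteq> 0} \<subseteq> {a<..<b}"

text \<open>
  A finite signed Borel measure on \<open>(a,b)\<close> is a set function \<open>D = P - N\<close> with finite positive
  measures \<open>P\<close> and \<open>N\<close>, which need not be mutually singular; integration against \<open>D\<close> is the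
  difference of the integrals.  As \<open>measure\<close> vanishes off the \<open>\<sigma>\<close>-algebra, \<open>D\<close> is
  determined on all sets by its values on the Borel subsets of \<open>(a,b)\<close>.
\<close>

definition has_distr_deriv ::
    "real \<Rightarrow> real \<Rightarrow> (real \<Rightarrow> real) \<Rightarrow> (real set \<Rightarrow> real) \<Rightarrow> bool" where
  "has_distr_deriv a b u D \<longleftrightarrow>
     (\<exists>P N. finite_measure P \<and> sets P = sets (restrict_space borel {a<..<b}) \<and>
            finite_measure N \<and> sets N = sets (restrict_space borel {a<..<b}) \<and>
            D = (\<lambda>A. measure P A - measure N A) \<and>
            (\<forall>\<phi>. test_function a b \<phi> \<longrightarrow>
               (LINT x:{a<..<b}|lebesgue. u x * deriv \<phi> x)
                 = - ((LINT x|P. \<phi> x) - (LINT x|N. \<phi> x))))"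

definition BV :: "real \<Rightarrow> real \<Rightarrow> (real \<Rightarrow> real) set" where
  "BV a b = {u. u absolutely_integrable_on {a<..<b} \<and> (\<exists>D. has_distr_deriv a b u D)}"

definition distr_deriv :: "real \<Rightarrow> real \<Rightarrow> (real \<Rightarrow> real) \<Rightarrow> real set \<Rightarrow> real" where
  "distr_deriv a b u = (THE D. has_distr_deriv a b u D)"

definition variation :: "(real set \<Rightarrow> real) \<Rightarrow> real set \<Rightarrow> ennreal" where
  "variation D A =
     (SUP Q \<in> {Q. finite Q \<and> partition_on A Q \<and> Q \<subseteq> sets borel}. \<Sum>B\<in>Q. ennreal \<bar>D B\<bar>)"

text \<open>
  One-sided limits are taken modulo Lebesgue null sets, i.e. they are the one-sided limits of a
  good representative.
\<close>

definition ess_at_right :: "real \<Rightarrow> real filter" where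
  "ess_at_right x = inf (at_right x) (ae_filter lebesgue)"

definition ess_at_left :: "real \<Rightarrow> real filter" where
  "ess_at_left x = inf (at_left x) (ae_filter lebesgue)"

definition right_value :: "(real \<Rightarrow> real) \<Rightarrow> real \<Rightarrow> real" where
  "right_value u x = Lim (ess_at_right x) u"

definition left_value :: "(real \<Rightarrow> real) \<Rightarrow> real \<Rightarrow> real" where
  "left_value u x = Lim (ess_at_left x) u"

definition jump_set :: "real \<Rightarrow> real \<Rightarrow> (real \<Rightarrow> real) \<Rightarrow> real set" where
  "jump_set a b u =
     {x \<in> {a<..<b}. \<exists>l r. (u \<longlongrightarrow> l) (ess_at_left x) \<and> (u \<longlongrightarrow> r) (ess_at_right x) \<and> l \<noteq> r}"

definition TV_K :: "(real \<Rightarrow> real) \<Rightarrow> real \<Rightarrow> real \<Rightarrow> (real \<Rightarrow> real) \<Rightarrow> ennreal" where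
  "TV_K K a b u =
     variation (distr_deriv a b u) ({a<..<b} - jump_set a b u)
     + (\<Sum>\<^sub>\<infinity>x\<in>jump_set a b u. ennreal (K \<bar>right_value u x - left_value u x\<bar>))"

definition TV_Kg ::
    "(real \<Rightarrow> real) \<Rightarrow> (real \<Rightarrow> real) \<Rightarrow> real \<Rightarrow> real \<Rightarrow> real \<Rightarrow> (real \<Rightarrow> real) \<Rightarrow> ennreal" where
  "TV_Kg K g lam a b u =
     TV_K K a b u + ennreal (lam / 2) * (\<integral>\<^sup>+x\<in>{a<..<b}. ennreal (\<bar>u x - g x\<bar>\<^sup>2) \<partial>lebesgue)"

definition piecewise_constant :: "real \<Rightarrow> real \<Rightarrow> (real \<Rightarrow> real) \<Rightarrow> bool" where
  "piecewise_constant a b u \<longleftrightarrow>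
     (\<exists>n t. t 0 = a \<and> t n = b \<and>
        (\<forall>i<n. t i < t (Suc i) \<and> u constant_on {t i<..<t (Suc i)}))"

end

theory Submission
  imports Defs
begin

text \<open>
  Since \<open>g\<close> is the identity, only the set \<open>R\<close> of values of a competitor \<open>u\<close> matters for a lower
  bound: the fidelity term is at least the integral of the squared distance to \<open>R\<close>.  As \<open>K\<close> is
  monotone and subadditive with \<open>K \<rho> \<le> \<rho>\<close>, sampling \<open>u\<close> on a finite partition does not increase
  \<open>TV_K\<close>, and sorting the sampled values does not increase the sum of \<open>K\<close> over consecutive values.
  Hence \<open>TV_Kg\<close> is bounded below by the infimum, over all finite lists of gaps \<open>h\<^sub>i \<ge> 0\<close> with
  \<open>H = \<Sum> h\<^sub>i \<le> L = b - a\<close>, of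
  \<open>\<Sum> (K h\<^sub>i + \<lambda> h\<^sub>i\<^sup>3 / 24) + \<lambda> (L - H)\<^sup>3 / 24\<close>,
  and a monotone step function jumping at the midpoints of the gaps attains the value of its list.

  In the reduced problem let \<open>\<lambda>\<close> be the least parameter for which some pair of gaps that should not
  be merged is at least as good as every single gap.  There the minima over one and over two gaps
  agree, concavity of \<open>K\<close> keeps both gaps of the pair positive, and convexity of the cube lets one
  move a gap from a longer list to the optimal single gap, so that three or more gaps never do
  better.
\<close>

section \<open>The reduced finite-dimensional problem\<close>

text \<open>The two pieces of [a, b] outside the extreme values of a competitor cost least when they
  are equal, and then together as much fidelity as one gap of the same total length; hence the last
  cube has the same constant as the others, but no \<open>K\<close>. The obstacle is that a pair
  containing a zero gap is a single gap in disguise, so comparing minima over pairs and over singles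
  does not by itself give two genuine jumps. The sign of \<open>merge_coeff\<close>, which is what
  remains of the cost of merging after the factor x * y is removed, survives in that limit: it is
  negative for \<lambda> = 0 and for small gaps, and a weak sign condition on it is closed. So
  compactness yields a least parameter, and a degenerate pair there would be beaten by splitting its
  gap in half. The same sign drives the induction over lists: a pair that resists merging is longer
  in total than the optimal single gap, which leaves room to move another gap next to the latter. On
  the side of BV everything is read off from the left-continuous distribution function of the
  derivative, so that grid points approaching from the left recover the fidelity in the
  limit.\<close>

definition sat :: "real \<Rightarrow> real" where
  "sat h = h / (1 + h)"

text \<open>The nearest value changes halfway between two consecutive values, so a gap h contributes
  2 * (h/2)^3 / 3 = h^3 / 12 to the integral of the squared distance; the factor l / 2 turns this
  into l / 24. The last term is the same quantity for two end pieces of length (L - H) / 2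
  each.\<close>

definition energy :: "real \<Rightarrow> real \<Rightarrow> real list \<Rightarrow> real" where
  "energy l L hs = (\<Sum>h\<leftarrow>hs. sat h + l / 24 * h ^ 3) + l / 24 * (L - sum_list hs) ^ 3"

lemma energy_single: "energy l L [h] = sat h + l / 24 * (h ^ 3 + (L - h) ^ 3)"
  by (simp add: energy_def algebra_simps)

lemma energy_pair:
  "energy l L [x, y] = sat x + sat y + l / 24 * (x ^ 3 + y ^ 3 + (L - x - y) ^ 3)"
  by (simp add: energy_def algebra_simps)

lemma sat_0 [simp]: "sat 0 = 0"
  by (simp add: sat_def)

lemma sat_nonneg: "0 \<le> h \<Longrightarrow> 0 \<le> sat h"
  by (simp add: sat_def)

lemma sat_pos: "0 < h \<Longrightarrow> 0 < sat h"
  by (simp add: sat_def)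

lemma sat_le: "0 \<le> h \<Longrightarrow> sat h \<le> h"
  by (simp add: sat_def divide_le_eq mult_le_cancel_left1 algebra_simps)

lemma sat_le_1: "0 \<le> h \<Longrightarrow> sat h \<le> 1"
  by (simp add: sat_def)

lemma sat_mono: "0 \<le> x \<Longrightarrow> x \<le> y \<Longrightarrow> sat x \<le> sat y"
  by (simp add: sat_def frac_le_eq divide_simps algebra_simps)

lemma sat_defect:
  assumes "0 \<le> x" "0 \<le> y"
  shows "sat x + sat y - sat (x + y) = x * y * (2 + x + y) / ((1 + x) * (1 + y) * (1 + x + y))"
  using assms by (simp add: sat_def divide_simps) (simp add: algebra_simps)

lemma sat_subadd: "0 \<le> x \<Longrightarrow> 0 \<le> y \<Longrightarrow> sat (x + y) \<le> sat x + sat y"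
  using sat_defect[of x y] by (smt (verit) divide_nonneg_nonneg mult_nonneg_nonneg)

lemma continuous_on_sat: "continuous_on {0..} sat"
  unfolding sat_def by (intro continuous_intros) auto

text \<open>Merging x and y adds 3 x y (x + y) to the cubes and saves the subadditivity defect of
  \<open>sat\<close>. Both contain the factor x * y; dividing it out and clearing positive
  denominators leaves this expression, whose sign still carries information when one gap is
  zero.\<close>

definition merge_coeff :: "real \<Rightarrow> real \<Rightarrow> real \<Rightarrow> real" where
  "merge_coeff l x y = l / 8 * (x + y) * (1 + x) * (1 + y) * (1 + x + y) - (2 + x + y)"

lemma energy_merge_diff:
  assumes "0 \<le> x" "0 \<le> y"
  shows "energy l L ((x + y) # hs) - energy l L (x # y # hs)
    = x * y * merge_coeff l x y / ((1 + x) * (1 + y) * (1 + x + y))"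
proof -
  have d: "(1 + x) * (1 + y) * (1 + x + y) > 0"
    using assms by simp
  have "energy l L ((x + y) # hs) - energy l L (x # y # hs)
      = l / 8 * (x * y * (x + y)) - (sat x + sat y - sat (x + y))"
    by (simp add: energy_def algebra_simps power3_eq_cube)
  also have "\<dots> = l / 8 * (x * y * (x + y)) - x * y * (2 + x + y) / ((1 + x) * (1 + y) * (1 + x + y))"
    using sat_defect[OF assms] by simp
  also have "\<dots> = x * y * merge_coeff l x y / ((1 + x) * (1 + y) * (1 + x + y))"
    using d by (simp add: merge_coeff_def field_simps)
  finally show ?thesis .
qed

lemma energy_merge_less_iff:
  assumes "0 \<le> x" "0 \<le> y"
  shows "energy l L (x # y # hs) < energy l L ((x + y) # hs)
    \<longleftrightarrow> 0 < x \<and> 0 < y \<and> 0 < merge_coeff l x y"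
proof -
  have "(1 + x) * (1 + y) * (1 + x + y) > 0"
    using assms by simp
  then have "energy l L (x # y # hs) < energy l L ((x + y) # hs) \<longleftrightarrow> 0 < x * y * merge_coeff l x y"
    using energy_merge_diff[OF assms, of l L hs] by (smt (verit) zero_less_divide_iff)
  also have "\<dots> \<longleftrightarrow> 0 < x \<and> 0 < y \<and> 0 < merge_coeff l x y"
    using assms by (cases "x = 0"; cases "y = 0") (auto simp: zero_less_mult_iff mult_less_0_iff)
  finally show ?thesis .
qed

text \<open>With the sum fixed, the gaps enter only through (1 + x) * (1 + y) = 1 + (x + y) + x * y,
  with a nonnegative factor. So merging is least favourable for balanced pairs.\<close>

lemma merge_coeff_mono:
  assumes "0 \<le> l" "0 \<le> x" "0 \<le> y" "0 \<le> x'" "0 \<le> y'" "x' + y' = x + y" "x * y \<le> x' * y'"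
  shows "merge_coeff l x y \<le> merge_coeff l x' y'"
proof -
  have "(1 + x) * (1 + y) \<le> (1 + x') * (1 + y')"
    using assms by (simp add: algebra_simps)
  then have "l / 8 * (x + y) * (1 + x + y) * ((1 + x) * (1 + y))
      \<le> l / 8 * (x + y) * (1 + x + y) * ((1 + x') * (1 + y'))"
    using assms by (intro mult_left_mono) auto
  moreover have "merge_coeff l u v = l / 8 * (u + v) * (1 + (u + v)) * ((1 + u) * (1 + v)) - (2 + (u + v))"
    for u v by (simp add: merge_coeff_def add_ac mult_ac)
  ultimately show ?thesis
    using assms(6) by (simp add: add_ac)
qed

text \<open>For a given sum the equal halves have the largest coefficient, and for halves its sign
  is that of an increasing function of the sum minus 1. If it is not positive at h, no pair with sum
  at most h has a positive one. In the application h is the optimal single gap, which splitting in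
  half does not improve.\<close>

lemma unmergeable_sum_gt:
  assumes "0 < l" "0 \<le> x" "0 \<le> y" "0 \<le> h"
    and split: "merge_coeff l (h / 2) (h / 2) \<le> 0" and pos: "0 < merge_coeff l x y"
  shows "h < x + y"
proof (rule ccontr)
  assume "\<not> h < x + y"
  then have s: "x + y \<le> h" by simp
  define s where "s = x + y"
  have c: "merge_coeff l (r / 2) (r / 2) = (2 + r) * (l / 16 * (r * (1 + r / 2) * (1 + r)) - 1)" for r
    by (simp add: merge_coeff_def field_simps)
  have "x * y \<le> (s / 2) * (s / 2)"
    using sum_squares_ge_zero[of "x - y" 0] by (simp add: s_def algebra_simps power2_eq_square)
  then have "0 < merge_coeff l (s / 2) (s / 2)"
    using merge_coeff_mono[of l x y "s/2" "s/2"] assms pos by (simp add: s_def)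
  then have "l / 16 * (s * (1 + s / 2) * (1 + s)) > 1"
    unfolding c using assms by (simp add: zero_less_mult_iff s_def)
  moreover have "s * (1 + s / 2) * (1 + s) \<le> h * (1 + h / 2) * (1 + h)"
    using s assms by (intro mult_mono) (auto simp: s_def)
  ultimately have "l / 16 * (h * (1 + h / 2) * (1 + h)) > 1"
    using assms(1) by (smt (verit) divide_pos_pos mult_left_mono)
  then have "0 < merge_coeff l (h / 2) (h / 2)"
    unfolding c using assms by (simp add: zero_less_mult_iff)
  with split show False by simp
qed

section \<open>From any number of gaps to at most two\<close>

lemma cube_exchange:
  fixes p q z :: real
  assumes "0 \<le> p" "0 \<le> z" "p + z \<le> q"
  shows "(q - z) ^ 3 + (p + z) ^ 3 \<le> p ^ 3 + q ^ 3"
proof -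
  have "p ^ 3 + q ^ 3 - (q - z) ^ 3 - (p + z) ^ 3 = 3 * z * (q - z - p) * (q + p)"
    by (simp add: power3_eq_cube algebra_simps)
  moreover have "\<dots> \<ge> 0" using assms by (intro mult_nonneg_nonneg) auto
  ultimately show ?thesis by linarith
qed

text \<open>The costs of the gaps themselves cancel and only the end terms change. Since h \<le>
  \<open>sum_list hs\<close>, giving z to [h] replaces two end lengths by less unequal ones with the
  same total, which lowers the sum of cubes by convexity.\<close>

lemma energy_move:
  assumes "0 < l" "0 \<le> z" "h \<le> sum_list hs" "z + sum_list hs \<le> L"
  shows "energy l L [h, z] + energy l L hs \<le> energy l L [h] + energy l L (z # hs)"
proof -
  have "(L - h - z) ^ 3 + (L - sum_list hs) ^ 3 \<le> (L - z - sum_list hs) ^ 3 + (L - h) ^ 3"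
    using cube_exchange[of "L - z - sum_list hs" z "L - h"] assms by (simp add: algebra_simps)
  then have "l / 24 * ((L - h - z) ^ 3 + (L - sum_list hs) ^ 3)
      \<le> l / 24 * ((L - z - sum_list hs) ^ 3 + (L - h) ^ 3)"
    using assms by (intro mult_left_mono) auto
  then show ?thesis
    by (simp add: energy_def algebra_simps)
qed

text \<open>If merging the first two gaps does not increase the energy, the shorter list settles the
  claim. Otherwise their sum exceeds h, so the third gap z can be moved to [h]; both [h, z] and the
  list without z are already known to cost at least as much as [h], and the bound for the full list
  follows by subtraction.\<close>

lemma energy_ge:
  assumes l: "0 < l" and h: "0 \<le> h" "h \<le> L"
    and e1: "\<And>x. 0 \<le> x \<Longrightarrow> x \<le> L \<Longrightarrow> energy l L [h] \<le> energy l L [x]"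
    and e2: "\<And>x y. 0 \<le> x \<Longrightarrow> 0 \<le> y \<Longrightarrow> x + y \<le> L \<Longrightarrow> energy l L [h] \<le> energy l L [x, y]"
  shows "\<forall>x\<in>set hs. 0 \<le> x \<Longrightarrow> sum_list hs \<le> L \<Longrightarrow> energy l L [h] \<le> energy l L hs"
proof (induction "length hs" arbitrary: hs rule: less_induct)
  case less
  consider "hs = []" | x where "hs = [x]" | x y where "hs = [x, y]"
    | x y z ks where "hs = x # y # z # ks"
    by (metis list.exhaust)
  then show ?case
  proof cases
    case 1
    have "energy l L [0] = energy l L []" by (simp add: energy_def)
    then show ?thesis using e1[of 0] h 1 by simp
  next
    case 2
    then show ?thesis using e1 less.prems by simp
  next
    case 3
    then show ?thesis using e2 less.prems by simp
  next
    case (4 x y z ks)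
    have nn: "0 \<le> x" "0 \<le> y" "0 \<le> z" "\<forall>x\<in>set ks. 0 \<le> x" "0 \<le> sum_list ks"
      using less.prems 4 by (auto intro: sum_list_nonneg)
    show ?thesis
    proof (cases "energy l L (x # y # z # ks) < energy l L ((x + y) # z # ks)")
      case False
      have "energy l L [h] \<le> energy l L ((x + y) # z # ks)"
        using less.prems 4 nn by (intro less.hyps) auto
      then show ?thesis using False 4 by simp
    next
      case True
      then have pos: "0 < merge_coeff l x y" using energy_merge_less_iff nn by blast
      have "merge_coeff l (h / 2) (h / 2) \<le> 0"
      proof (cases "h = 0")
        case True
        then show ?thesis by (simp add: merge_coeff_def)
      next
        case False
        have "\<not> energy l L [h / 2, h / 2] < energy l L [h / 2 + h / 2]"
          using e2[of "h/2" "h/2"] h by simp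
        then show ?thesis using energy_merge_less_iff[of "h/2" "h/2" l L "[]"] h False by auto
      qed
      then have "h < x + y" using unmergeable_sum_gt[OF l _ _ _ _ pos] nn h by blast
      then have "energy l L [h, z] + energy l L (x # y # ks) \<le> energy l L [h] + energy l L (z # x # y # ks)"
        using less.prems nn 4 l by (intro energy_move) auto
      moreover have "energy l L [h] \<le> energy l L [h, z]"
        using less.prems nn 4 h \<open>h < x + y\<close> by (intro e2) auto
      moreover have "energy l L [h] \<le> energy l L (x # y # ks)"
        using less.prems nn 4 by (intro less.hyps) auto
      moreover have "energy l L (z # x # y # ks) = energy l L hs"
        using 4 by (simp add: energy_def algebra_simps)
      ultimately show ?thesis using e1[of h] h by linarith
    qed
  qed
qed

section \<open>The critical parameter\<close>

lemma merge_coeff_sym: "merge_coeff l x y = merge_coeff l y x"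
  by (simp add: merge_coeff_def algebra_simps)

lemma continuous_on_sat_comp: "continuous_on S f \<Longrightarrow> (\<And>x. x \<in> S \<Longrightarrow> 0 \<le> f x) \<Longrightarrow> continuous_on S (\<lambda>x. sat (f x))"
  by (rule continuous_on_compose2[OF continuous_on_sat]) auto

text \<open>Power mean inequality: among all splittings of a length in two, the equal one has the
  least sum of cubes. It bounds single gaps from below at the largest parameter and balances the two
  end pieces of the range.\<close>

lemma cube_sum_ge:
  fixes x y :: real
  assumes "0 \<le> x" "0 \<le> y"
  shows "(x + y) ^ 3 \<le> 4 * (x ^ 3 + y ^ 3)"
proof -
  have "4 * (x ^ 3 + y ^ 3) - (x + y) ^ 3 = 3 * (x + y) * (x - y)\<^sup>2"
    by (simp add: power3_eq_cube power2_eq_square algebra_simps)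
  moreover have "\<dots> \<ge> 0" using assms by simp
  ultimately show ?thesis by linarith
qed

lemma critical_parameter:
  fixes L :: real
  assumes L: "0 < L"
  obtains l h x y where "0 < l" "0 < h" "h < L" "0 < x" "0 < y" "x + y \<le> L"
    "energy l L [x, y] = energy l L [h]"
    "\<And>hs. \<forall>z\<in>set hs. 0 \<le> z \<Longrightarrow> sum_list hs \<le> L \<Longrightarrow> energy l L [h] \<le> energy l L hs"
proof -
  \<comment> \<open>At this value the pair (L/3, L/3) costs at most 2 + 400/216 < 4, whereas every
    single gap costs at least 400/96 > 4. So the set \<open>A\<close> below is not empty.\<close>
  define lmax where "lmax = 400 / L ^ 3"
  have lmax: "0 < lmax" using L by (simp add: lmax_def)
  define B where "B = {0..lmax} \<times> {0..L} \<times> {0..L}"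
  define T where "T = {p \<in> {0..L} \<times> {0..L}. fst p + snd p \<le> L}"
  \<comment> \<open>Pairs that are at least as good as every single gap, together with their
    parameter. All conditions are weak inequalities, so \<open>A\<close> is compact and its first
    coordinate attains a minimum; the condition on \<open>merge_coeff\<close> stands in for
    positivity of both gaps, which is not closed.\<close>
  define A where "A = {p \<in> B. fst (snd p) + snd (snd p) \<le> L} \<inter>
      {p \<in> B. 0 \<le> merge_coeff (fst p) (fst (snd p)) (snd (snd p))} \<inter>
      (\<Inter>h\<in>{0..L}. {p \<in> B. energy (fst p) L [fst (snd p), snd (snd p)] \<le> energy (fst p) L [h]})"
  have inA: "(l, x, y) \<in> A \<longleftrightarrow> 0 \<le> l \<and> l \<le> lmax \<and> 0 \<le> x \<and> 0 \<le> y \<and> x + y \<le> L \<and>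
      0 \<le> merge_coeff l x y \<and> (\<forall>h\<in>{0..L}. energy l L [x, y] \<le> energy l L [h])" for l x y
    using L unfolding A_def B_def by auto
  have compB: "compact B" unfolding B_def by (intro compact_Times compact_Icc)
  then have clB: "closed B" by (rule compact_imp_closed)
  have compT: "compact T"
  proof -
    have "T = ({0..L} \<times> {0..L}) \<inter> {p. fst p + snd p \<le> L}" by (auto simp: T_def)
    then show ?thesis
      by (auto intro!: compact_Int_closed compact_Times closed_Collect_le continuous_intros)
  qed
  have "closed A"
    unfolding A_def energy_pair energy_single merge_coeff_def
    by (intro closed_Int closed_INT ballI continuous_on_closed_Collect_le clB
        continuous_intros continuous_on_sat_comp) (auto simp: B_def)
  moreover have "A \<subseteq> B" unfolding A_def by blast
  ultimately have compA: "compact A"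
    using compact_Int_closed[OF compB, of A] by (simp add: Int_absorb1)
  have min1: "\<exists>h\<in>{0..L}. \<forall>h'\<in>{0..L}. energy l L [h] \<le> energy l L [h']" for l
    unfolding energy_single using L
    by (intro continuous_attains_inf continuous_intros continuous_on_sat_comp) auto
  have min2: "\<exists>p\<in>T. \<forall>q\<in>T. energy l L [fst p, snd p] \<le> energy l L [fst q, snd q]" for l
    unfolding energy_pair
  proof (intro continuous_attains_inf compT)
    show "T \<noteq> {}" using L by (auto simp: T_def intro!: exI[of _ 0])
    show "continuous_on T (\<lambda>x. sat (fst x) + sat (snd x) + l / 24 * (fst x ^ 3 + snd x ^ 3 + (L - fst x - snd x) ^ 3))"
      by (intro continuous_intros continuous_on_sat_comp) (auto simp: T_def)
  qed
  \<comment> \<open>The single gap x + y is among the competitors, and beating it strictly is what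
    the merging criterion describes.\<close>
  have unmerge: "0 < x \<and> 0 < y \<and> 0 < merge_coeff l x y"
    if "0 \<le> x" "0 \<le> y" "x + y \<le> L" "\<forall>h\<in>{0..L}. energy l L [x, y] < energy l L [h]" for l x y
    using energy_merge_less_iff[of x y l L "[]"] that by auto
  have "A \<noteq> {}"
  proof -
    have "energy lmax L [L/3, L/3] < energy lmax L [h]" if "h \<in> {0..L}" for h
    proof -
      have l3: "lmax * L ^ 3 = 400" using L by (simp add: lmax_def)
      have "energy lmax L [L/3, L/3] \<le> 2 + lmax * L ^ 3 / 216"
        using sat_le_1[of "L/3"] L unfolding energy_pair by (simp add: power_divide field_simps power3_eq_cube)
      moreover have "lmax * L ^ 3 / 96 \<le> energy lmax L [h]"
      proof -
        have "lmax / 96 * L ^ 3 \<le> lmax / 96 * (4 * (h ^ 3 + (L - h) ^ 3))"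
          using cube_sum_ge[of h "L - h"] that lmax by (intro mult_left_mono) auto
        then show ?thesis using sat_nonneg[of h] that unfolding energy_single by (simp add: distrib_left)
      qed
      ultimately show ?thesis unfolding l3 by simp
    qed
    then have "(lmax, L/3, L/3) \<in> A"
      unfolding inA using unmerge[of "L/3" "L/3" lmax] L lmax by (auto intro: less_imp_le)
    then show ?thesis by blast
  qed
  then obtain p where "p \<in> A" "\<forall>q\<in>A. fst p \<le> fst q"
    using continuous_attains_inf[OF compA, of fst] continuous_on_fst[OF continuous_on_id] by blast
  then obtain l x y where A: "(l, x, y) \<in> A" and lmin: "\<And>l' x' y'. (l', x', y') \<in> A \<Longrightarrow> l \<le> l'"
  proof (cases p)
    case (fields l x y)
    show thesis
    proof (rule that[of l x y])
      show "(l, x, y) \<in> A" using \<open>p \<in> A\<close> fields by simp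
      show "l \<le> l'" if "(l', x', y') \<in> A" for l' x' y'
        using \<open>\<forall>q\<in>A. fst p \<le> fst q\<close>[rule_format, OF that] fields by simp
    qed
  qed
  note A' = A[unfolded inA]
  have lpos: "0 < l"
    using A' by (cases "l = 0") (auto simp: merge_coeff_def)
  obtain h where h: "0 \<le> h" "h \<le> L" "\<And>h'. 0 \<le> h' \<Longrightarrow> h' \<le> L \<Longrightarrow> energy l L [h] \<le> energy l L [h']"
    using min1[of l] by auto
  \<comment> \<open>If a pair beat all single gaps by a margin g > 0, all conditions defining
    \<open>A\<close> would survive a small decrease of the parameter, contrary to the minimality of
    l.\<close>
  have le2: "energy l L [h] \<le> energy l L [x', y']" if xy: "0 \<le> x'" "0 \<le> y'" "x' + y' \<le> L" for x' y'
  proof (rule ccontr)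
    define g where "g = energy l L [h] - energy l L [x', y']"
    assume "\<not> energy l L [h] \<le> energy l L [x', y']"
    then have g: "g > 0" by (simp add: g_def)
    then have lt: "\<forall>k\<in>{0..L}. energy l L [x', y'] + g \<le> energy l L [k]"
      using h by (auto simp: g_def)
    have "\<forall>k\<in>{0..L}. energy l L [x', y'] < energy l L [k]"
    proof
      fix k assume "k \<in> {0..L}"
      then show "energy l L [x', y'] < energy l L [k]" using lt[rule_format, of k] g by linarith
    qed
    then have um: "0 < x' \<and> 0 < y' \<and> 0 < merge_coeff l x' y'" by (rule unmerge[OF xy])
    define c where "c = (x' + y') * (1 + x') * (1 + y') * (1 + x' + y')"
    have c: "c > 0" using um by (simp add: c_def)
    define d where "d = min l (min (12 * g / L ^ 3) (8 * merge_coeff l x' y' / c))"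
    have d: "d > 0" "d \<le> l" "d \<le> 12 * g / L ^ 3" "d \<le> 8 * merge_coeff l x' y' / c"
      using lpos g L um c by (auto simp: d_def)
    have "(l - d, x', y') \<in> A"
      unfolding inA
    proof (intro conjI ballI)
      have "merge_coeff (l - d) x' y' = merge_coeff l x' y' - d / 8 * c"
      proof -
        have "merge_coeff r x' y' = r / 8 * c - (2 + x' + y')" for r
          by (simp add: merge_coeff_def c_def mult_ac)
        then show ?thesis by (simp add: left_diff_distrib diff_divide_distrib)
      qed
      then show "0 \<le> merge_coeff (l - d) x' y'" using d(4) c by (simp add: field_simps)
      fix k assume k: "k \<in> {0..L}"
      have "d * L ^ 3 \<le> 12 * g" using d(3) L by (simp add: field_simps)
      moreover have "d * (k ^ 3 + (L - k) ^ 3) \<le> d * (2 * L ^ 3)"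
      proof (rule mult_left_mono)
        have "k ^ 3 \<le> L ^ 3" "(L - k) ^ 3 \<le> L ^ 3" using k by (auto intro!: power_mono)
        then show "k ^ 3 + (L - k) ^ 3 \<le> 2 * L ^ 3" by linarith
      qed (use d in simp)
      moreover have "0 \<le> d * (x' ^ 3 + y' ^ 3 + (L - x' - y') ^ 3)"
        using d xy by (intro mult_nonneg_nonneg add_nonneg_nonneg) auto
      moreover have "energy (l - d) L [x', y'] = energy l L [x', y'] - d * (x' ^ 3 + y' ^ 3 + (L - x' - y') ^ 3) / 24"
        "energy (l - d) L [k] = energy l L [k] - d * (k ^ 3 + (L - k) ^ 3) / 24"
        unfolding energy_pair energy_single by (simp_all add: algebra_simps diff_divide_distrib add_divide_distrib)
      moreover have "energy l L [x', y'] + g \<le> energy l L [k]" using lt k by blast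
      ultimately show "energy (l - d) L [x', y'] \<le> energy (l - d) L [k]" by argo
    qed (use d A' xy in auto)
    then have "l \<le> l - d" by (rule lmin)
    then show False using d by simp
  qed
  have eq: "energy l L [x, y] = energy l L [h]"
    using le2[of x y] A' h(1,2) by (intro antisym) auto
  \<comment> \<open>Excludes single gaps in disguise: if an optimal z had a nonnegative coefficient
    against 0, its halves, having a larger product, would have a strictly positive one and beat z,
    contrary to \<open>le2\<close>.\<close>
  have nosplit: "False" if z: "0 \<le> z" "z \<le> L" "0 \<le> merge_coeff l z 0" "energy l L [z] = energy l L [h]" for z
  proof -
    have z0: "z > 0" using z by (cases "z = 0") (auto simp: merge_coeff_def)
    have "merge_coeff l z 0 < merge_coeff l (z/2) (z/2)"
    proof -
      have "merge_coeff l (z/2) (z/2) - merge_coeff l z 0 = l / 8 * z * (z * z / 4) * (1 + z)"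
        by (simp add: merge_coeff_def field_simps)
      moreover have "\<dots> > 0" using z0 lpos by simp
      ultimately show ?thesis by simp
    qed
    then have "energy l L [z/2, z/2] < energy l L [z]"
      using energy_merge_less_iff[of "z/2" "z/2" l L "[]"] z z0 by auto
    then show False using le2[of "z/2" "z/2"] z by auto
  qed
  have y0: "y \<noteq> 0"
  proof
    assume "y = 0"
    then show False using nosplit[of x] A' eq by (auto simp: energy_pair energy_single)
  qed
  have x0: "x \<noteq> 0"
  proof
    assume "x = 0"
    then show False using nosplit[of y] A' eq by (auto simp: energy_pair energy_single merge_coeff_sym[of l 0])
  qed
  have xy: "0 < x" "0 < y" "x + y \<le> L" using A' x0 y0 by auto
  have "h \<noteq> 0"
  proof
    assume h0: "h = 0"
    \<comment> \<open>Two gaps that do not pay singly do not pay together: the excess of the pair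
      over no gap is the sum of the two single excesses plus a positive interaction from the end
      terms.\<close>
    have "energy l L [x, y] + energy l L [0] = energy l L [x] + energy l L [y] + l / 8 * (x * y * (2 * L - x - y))"
      by (simp add: energy_def power3_eq_cube algebra_simps)
    moreover have "l / 8 * (x * y * (2 * L - x - y)) > 0" using lpos xy L by simp
    moreover have "energy l L [h] \<le> energy l L [x]" "energy l L [h] \<le> energy l L [y]" using h xy by auto
    ultimately show False using eq h0 by simp
  qed
  moreover have "h \<noteq> L"
  proof
    assume "h = L"
    then have "energy l L [h] > energy l L [0]" using sat_pos[OF L] by (simp add: energy_single)
    then show False using h(3)[of 0] L by simp
  qed
  ultimately have hh: "0 < h" "h < L" using h by auto
  show thesis
    by (rule that[OF lpos hh xy eq]) (rule energy_ge[OF lpos h(1,2,3) le2], auto)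
qed

section \<open>Finite sets of values\<close>

fun gaps :: "real list \<Rightarrow> real list" where
  "gaps (x # y # zs) = (y - x) # gaps (y # zs)"
| "gaps _ = []"

lemma gaps_nonneg: "sorted xs \<Longrightarrow> h \<in> set (gaps xs) \<Longrightarrow> 0 \<le> h"
  by (induction xs rule: gaps.induct) auto

lemma sum_list_gaps: "xs \<noteq> [] \<Longrightarrow> sum_list (gaps xs) = last xs - hd xs"
  by (induction xs rule: gaps.induct) auto

text \<open>If v splits a gap, the part on the side of w is no longer than the distance to w, and
  the other part is no longer than the gap it came from. If v extends the range, the new gap is no
  longer than the distance to w. Monotonicity of \<open>sat\<close> does the rest.\<close>

lemma sum_gaps_insort:
  assumes "sorted xs" "w \<in> set xs"
  shows "(\<Sum>h\<leftarrow>gaps (insort v xs). sat h) \<le> sat \<bar>v - w\<bar> + (\<Sum>h\<leftarrow>gaps xs. sat h)"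
  using assms
proof (induction xs arbitrary: w rule: gaps.induct)
  case (1 x y zs)
  show ?case
  proof (cases "v \<le> x")
    case True
    have "x \<le> w" using 1 by auto
    then have "sat (x - v) \<le> sat \<bar>v - w\<bar>" using True by (intro sat_mono) auto
    then show ?thesis using True by simp
  next
    case vx: False
    show ?thesis
    proof (cases "v \<le> y")
      case True
      show ?thesis
      proof (cases "w = x")
        case True
        have "sat (y - v) \<le> sat (y - x)" using vx \<open>v \<le> y\<close> by (intro sat_mono) auto
        then show ?thesis using True vx \<open>v \<le> y\<close> by simp
      next
        case False
        then have "y \<le> w" using 1 by auto
        then have "sat (y - v) \<le> sat \<bar>v - w\<bar>" using \<open>v \<le> y\<close> by (intro sat_mono) auto
        moreover have "sat (v - x) \<le> sat (y - x)" using vx \<open>v \<le> y\<close> by (intro sat_mono) auto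
        ultimately show ?thesis using vx \<open>v \<le> y\<close> by simp
      qed
    next
      case False
      \<comment> \<open>The recursion continues in the tail, so w has to lie there. If w = x, the
        next entry y takes its place; it is no farther from v because x \<le> y < v.\<close>
      define w' where "w' = (if w = x then y else w)"
      have "w' \<in> set (y # zs)" using 1 by (auto simp: w'_def)
      then have "(\<Sum>h\<leftarrow>gaps (insort v (y # zs)). sat h) \<le> sat \<bar>v - w'\<bar> + (\<Sum>h\<leftarrow>gaps (y # zs). sat h)"
        using 1 by auto
      moreover have "sat \<bar>v - w'\<bar> \<le> sat \<bar>v - w\<bar>"
        using False 1 by (intro sat_mono) (auto simp: w'_def)
      ultimately show ?thesis using vx False by simp
    qed
  qed
qed auto

text \<open>Insertion sort: the head x enters the sorted tail, which contains its former neighbour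
  y, so its insertion costs no more than the jump between x and y did.\<close>

lemma sum_gaps_sort_le:
  "(\<Sum>h\<leftarrow>gaps (sort vs). sat h) \<le> (\<Sum>h\<leftarrow>gaps vs. sat \<bar>h\<bar>)"
proof (induction vs rule: gaps.induct)
  case (1 x y zs)
  have "(\<Sum>h\<leftarrow>gaps (insort x (sort (y # zs))). sat h) \<le> sat \<bar>x - y\<bar> + (\<Sum>h\<leftarrow>gaps (sort (y # zs)). sat h)"
    by (rule sum_gaps_insort) (auto simp: set_insort_key sorted_insort)
  then show ?case using 1 by (simp add: abs_minus_commute)
qed auto

text \<open>Up to the midpoint the distance to S is at least the distance to x, afterwards at least
  the distance to y, whatever points S has outside the gap.\<close>

lemma integral_infdist_gap:
  fixes x y :: real
  assumes "x \<le> y" "S \<noteq> {}" "\<And>t z. z \<in> S \<Longrightarrow> z \<le> x \<or> y \<le> z"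
  shows "(y - x) ^ 3 / 12 \<le> integral {x..y} (\<lambda>t. (infdist t S)\<^sup>2)"
proof -
  define m where "m = (x + y) / 2"
  have m: "x \<le> m" "m \<le> y" using assms by (auto simp: m_def)
  have int: "(\<lambda>t. (infdist t S)\<^sup>2) integrable_on {p..q}" for p q
    by (intro integrable_continuous_interval continuous_intros)
  have lb: "min (t - x) (y - t) \<le> infdist t S" if "t \<in> {x..y}" for t
    unfolding infdist_notempty[OF assms(2)]
  proof (rule cINF_greatest[OF assms(2)])
    fix z assume "z \<in> S"
    then show "min (t - x) (y - t) \<le> dist t z" using assms(3)[of z] that by (auto simp: dist_real_def)
  qed
  have h1: "((\<lambda>t. (t - x)\<^sup>2) has_integral (m - x) ^ 3 / 3) {x..m}"
  proof -
    have "((\<lambda>t. (t - x)\<^sup>2) has_integral (m - x) ^ 3 / 3 - (x - x) ^ 3 / 3) {x..m}"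
      by (rule fundamental_theorem_of_calculus[OF m(1)])
        (auto intro!: derivative_eq_intros simp: has_real_derivative_iff_has_vector_derivative[symmetric] power2_eq_square)
    then show ?thesis by simp
  qed
  have h2: "((\<lambda>t. (y - t)\<^sup>2) has_integral (y - m) ^ 3 / 3) {m..y}"
  proof -
    have "((\<lambda>t. (y - t)\<^sup>2) has_integral - ((y - y) ^ 3 / 3) - (- ((y - m) ^ 3 / 3))) {m..y}"
      by (rule fundamental_theorem_of_calculus[OF m(2)])
        (auto intro!: derivative_eq_intros simp: has_real_derivative_iff_has_vector_derivative[symmetric] power2_eq_square)
    then show ?thesis by simp
  qed
  have "(m - x) ^ 3 / 3 \<le> integral {x..m} (\<lambda>t. (infdist t S)\<^sup>2)"
    unfolding h1[THEN integral_unique, symmetric]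
    using h1 int m lb by (intro integral_le) (auto intro!: power_mono has_integral_integrable intro: order_trans[rotated, OF lb] simp: m_def min_def field_simps)
  moreover have "(y - m) ^ 3 / 3 \<le> integral {m..y} (\<lambda>t. (infdist t S)\<^sup>2)"
    unfolding h2[THEN integral_unique, symmetric]
    using h2 int m lb by (intro integral_le) (auto intro!: power_mono has_integral_integrable intro: order_trans[rotated, OF lb] simp: m_def min_def field_simps)
  moreover have "integral {x..m} (\<lambda>t. (infdist t S)\<^sup>2) + integral {m..y} (\<lambda>t. (infdist t S)\<^sup>2)
      = integral {x..y} (\<lambda>t. (infdist t S)\<^sup>2)"
    using m int by (intro Henstock_Kurzweil_Integration.integral_combine) auto
  moreover have "(m - x) ^ 3 / 3 + (y - m) ^ 3 / 3 = (y - x) ^ 3 / 12"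
    by (simp add: m_def power3_eq_cube field_simps)
  ultimately show ?thesis by linarith
qed

text \<open>The set S stays fixed while the list shrinks in the induction; for this reason S may
  have points beyond both ends of the list.\<close>

lemma integral_infdist_ge:
  assumes "sorted xs" "xs \<noteq> []" "\<And>z. z \<in> S \<Longrightarrow> z \<le> hd xs \<or> last xs \<le> z \<or> z \<in> set xs" "S \<noteq> {}"
  shows "(\<Sum>h\<leftarrow>gaps xs. h ^ 3 / 12) \<le> integral {hd xs..last xs} (\<lambda>t. (infdist t S)\<^sup>2)"
  using assms
proof (induction xs rule: gaps.induct)
  case (1 x y zs)
  have int: "(\<lambda>t. (infdist t S)\<^sup>2) integrable_on {p..q}" for p q
    by (intro integrable_continuous_interval continuous_intros)
  have yl: "y \<le> last (y # zs)" using 1 by auto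
  have "(\<Sum>h\<leftarrow>gaps (y # zs). h ^ 3 / 12) \<le> integral {y..last (y # zs)} (\<lambda>t. (infdist t S)\<^sup>2)"
    using 1 by fastforce
  moreover have "(y - x) ^ 3 / 12 \<le> integral {x..y} (\<lambda>t. (infdist t S)\<^sup>2)"
    using 1 yl by (intro integral_infdist_gap) fastforce+
  moreover have "integral {x..y} (\<lambda>t. (infdist t S)\<^sup>2) + integral {y..last (y # zs)} (\<lambda>t. (infdist t S)\<^sup>2)
      = integral {x..last (y # zs)} (\<lambda>t. (infdist t S)\<^sup>2)"
    using 1 yl int by (intro Henstock_Kurzweil_Integration.integral_combine) auto
  ultimately show ?case by simp
qed auto

text \<open>Outside the hull of the values the distance is that to the nearer extreme value. This
  gives one cube for each end piece, and \<open>cube_sum_ge\<close> bounds their sum below by the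
  balanced end term of the energy.\<close>

lemma energy_le_values:
  fixes rs :: "real list"
  assumes "sorted rs" "rs \<noteq> []" "set rs \<subseteq> {a..b}" "0 \<le> l"
  shows "energy l (b - a) (gaps rs)
    \<le> (\<Sum>h\<leftarrow>gaps rs. sat h) + l / 2 * integral {a..b} (\<lambda>t. (infdist t (set rs))\<^sup>2)"
proof -
  let ?f = "\<lambda>t. (infdist t (set rs))\<^sup>2"
  define p where "p = hd rs"
  define q where "q = last rs"
  have pq: "a \<le> p" "q \<le> b" "p \<le> q" "\<And>z. z \<in> set rs \<Longrightarrow> p \<le> z \<and> z \<le> q"
  proof -
    show "p \<le> z \<and> z \<le> q" if "z \<in> set rs" for z
      using assms(1) that unfolding p_def q_def by (induction rs) auto
    then show "p \<le> q" using assms(2) p_def hd_in_set by blast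
    have "p \<in> {a..b}" "q \<in> {a..b}"
      using assms(3) hd_in_set[OF assms(2)] last_in_set[OF assms(2)] unfolding p_def q_def by blast+
    then show "a \<le> p" "q \<le> b" by auto
  qed
  have int: "?f integrable_on {p..q}" for p q
    by (intro integrable_continuous_interval continuous_intros)
  have ge: "p - t \<le> infdist t (set rs)" "t - q \<le> infdist t (set rs)" for t
    unfolding infdist_notempty[of "set rs", simplified, OF assms(2)]
    using assms(2) by (auto intro!: cINF_greatest simp: dist_real_def dest!: pq(4))
  have h1: "((\<lambda>t. (p - t)\<^sup>2) has_integral (p - a) ^ 3 / 3) {a..p}"
  proof -
    have "((\<lambda>t. (p - t)\<^sup>2) has_integral - ((p - p) ^ 3 / 3) - (- ((p - a) ^ 3 / 3))) {a..p}"
      by (rule fundamental_theorem_of_calculus[OF pq(1)])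
        (auto intro!: derivative_eq_intros simp: has_real_derivative_iff_has_vector_derivative[symmetric] power2_eq_square)
    then show ?thesis by simp
  qed
  have h2: "((\<lambda>t. (t - q)\<^sup>2) has_integral (b - q) ^ 3 / 3) {q..b}"
  proof -
    have "((\<lambda>t. (t - q)\<^sup>2) has_integral (b - q) ^ 3 / 3 - (q - q) ^ 3 / 3) {q..b}"
      by (rule fundamental_theorem_of_calculus[OF pq(2)])
        (auto intro!: derivative_eq_intros simp: has_real_derivative_iff_has_vector_derivative[symmetric] power2_eq_square)
    then show ?thesis by simp
  qed
  have "(p - a) ^ 3 / 3 \<le> integral {a..p} ?f"
    unfolding h1[THEN integral_unique, symmetric]
    using h1 int ge by (intro integral_le) (auto intro!: power_mono has_integral_integrable)
  moreover have "(b - q) ^ 3 / 3 \<le> integral {q..b} ?f"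
    unfolding h2[THEN integral_unique, symmetric]
    using h2 int ge by (intro integral_le) (auto intro!: power_mono has_integral_integrable)
  moreover have "(\<Sum>h\<leftarrow>gaps rs. h ^ 3 / 12) \<le> integral {p..q} ?f"
    unfolding p_def q_def using assms by (intro integral_infdist_ge) auto
  moreover have "integral {a..p} ?f + integral {p..q} ?f = integral {a..q} ?f"
    using pq int by (intro Henstock_Kurzweil_Integration.integral_combine) auto
  moreover have "integral {a..q} ?f + integral {q..b} ?f = integral {a..b} ?f"
    using pq int by (intro Henstock_Kurzweil_Integration.integral_combine) auto
  moreover have "((b - a) - sum_list (gaps rs)) ^ 3 \<le> 4 * ((p - a) ^ 3 + (b - q) ^ 3)"
  proof -
    have "(b - a) - sum_list (gaps rs) = (p - a) + (b - q)"
      using sum_list_gaps[OF assms(2)] by (simp add: p_def q_def)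
    then show ?thesis using cube_sum_ge[of "p - a" "b - q"] pq(1,2) by (simp only:)
  qed
  ultimately have "(\<Sum>h\<leftarrow>gaps rs. h ^ 3 / 12) + ((b - a) - sum_list (gaps rs)) ^ 3 / 12 \<le> integral {a..b} ?f"
    by argo
  then have "l / 2 * ((\<Sum>h\<leftarrow>gaps rs. h ^ 3 / 12) + ((b - a) - sum_list (gaps rs)) ^ 3 / 12) \<le> l / 2 * integral {a..b} ?f"
    using assms(4) by (intro mult_left_mono) auto
  moreover have "l / 2 * (\<Sum>h\<leftarrow>hs. h ^ 3 / 12) = (\<Sum>h\<leftarrow>hs. l / 24 * h ^ 3)" for hs
    by (induction hs) (auto simp: algebra_simps)
  ultimately show ?thesis
    by (simp add: energy_def sum_list_addf distrib_left)
qed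

section \<open>Test functions\<close>

definition smooth :: "(real \<Rightarrow> real) \<Rightarrow> bool" where
  "smooth f \<longleftrightarrow> (\<forall>n. (deriv ^^ n) f differentiable_on UNIV)"

lemma smooth_iff: "smooth f \<longleftrightarrow> f differentiable_on UNIV \<and> smooth (deriv f)"
proof -
  have "(\<forall>n. (deriv ^^ n) f differentiable_on UNIV) \<longleftrightarrow>
      f differentiable_on UNIV \<and> (\<forall>n. (deriv ^^ n) (deriv f) differentiable_on UNIV)"
  proof (intro iffI conjI allI)
    assume *: "\<forall>n. (deriv ^^ n) f differentiable_on UNIV"
    show "f differentiable_on UNIV" using *[rule_format, of 0] by simp
    show "(deriv ^^ n) (deriv f) differentiable_on UNIV" for n
      using *[rule_format, of "Suc n"] by (simp only: funpow_Suc_right o_def)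
  next
    fix n assume *: "f differentiable_on UNIV \<and> (\<forall>n. (deriv ^^ n) (deriv f) differentiable_on UNIV)"
    then show "(deriv ^^ n) f differentiable_on UNIV"
      by (cases n) (simp_all only: funpow_Suc_right o_def, simp_all)
  qed
  then show ?thesis by (simp add: smooth_def)
qed

text \<open>Smoothness is the largest property of functions that is preserved by differentiation, so
  membership in any family closed under derivatives suffices. Formulas for higher derivatives are
  thus avoided.\<close>

lemma smooth_coinduct:
  assumes "f \<in> F"
    and "\<And>f. f \<in> F \<Longrightarrow> \<exists>f'\<in>F. \<forall>x. (f has_field_derivative f' x) (at x)"
  shows "smooth f"
proof -
  have step: "f differentiable_on UNIV \<and> deriv f \<in> F" if "f \<in> F" for f
  proof -
    obtain f' where "f' \<in> F" "\<And>x. (f has_field_derivative f' x) (at x)"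
      using assms(2) \<open>f \<in> F\<close> by blast
    moreover from this have "deriv f = f'" by (auto intro!: DERIV_imp_deriv)
    ultimately show ?thesis
      by (auto simp: differentiable_on_def real_differentiable_def)
  qed
  have "(deriv ^^ n) f \<in> F" for n
    by (induction n) (use assms(1) step in auto)
  then show ?thesis using step by (auto simp: smooth_def)
qed

lemma smooth_DERIV: "smooth f \<Longrightarrow> (f has_field_derivative deriv f x) (at x)"
  by (subst (asm) smooth_iff) (auto simp: differentiable_on_def real_differentiable_def DERIV_deriv_iff_real_differentiable)

lemma smooth_deriv: "smooth f \<Longrightarrow> smooth (deriv f)"
  using smooth_iff by blast

lemma smooth_continuous_on: "smooth f \<Longrightarrow> continuous_on S f"
  using smooth_DERIV DERIV_isCont continuous_at_imp_continuous_on by blast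

text \<open>A family closed under differentiation by the sum, product and chain rules. The base case
  allows an affine change of variable, which the scaled and reflected factors of a bump
  require.\<close>

inductive_set smooth_algebra :: "(real \<Rightarrow> real) set" where
  base: "smooth f \<Longrightarrow> (\<lambda>x. f (m * x + k)) \<in> smooth_algebra"
| const: "(\<lambda>_. c) \<in> smooth_algebra"
| add: "f \<in> smooth_algebra \<Longrightarrow> g \<in> smooth_algebra \<Longrightarrow> (\<lambda>x. f x + g x) \<in> smooth_algebra"
| mult: "f \<in> smooth_algebra \<Longrightarrow> g \<in> smooth_algebra \<Longrightarrow> (\<lambda>x. f x * g x) \<in> smooth_algebra"

lemma smooth_algebra_smooth:
  assumes "f \<in> smooth_algebra"
  shows "smooth f"
  using assms
proof (rule smooth_coinduct)
  fix f assume "f \<in> smooth_algebra"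
  then show "\<exists>f'\<in>smooth_algebra. \<forall>x. (f has_field_derivative f' x) (at x)"
  proof induction
    case (base f m k)
    have "((\<lambda>x. f (m * x + k)) has_field_derivative deriv f (m * x + k) * m) (at x)" for x
      by (rule DERIV_chain2[OF smooth_DERIV[OF base]]) (auto intro!: derivative_eq_intros)
    moreover have "(\<lambda>x. deriv f (m * x + k) * m) \<in> smooth_algebra"
      by (rule smooth_algebra.mult[OF smooth_algebra.base smooth_algebra.const]) (rule smooth_deriv[OF base])
    ultimately show ?case by (intro bexI[of _ "\<lambda>x. deriv f (m * x + k) * m"] allI)
  next
    case (const c)
    have "(\<lambda>_. 0) \<in> smooth_algebra" by (rule smooth_algebra.const)
    then show ?case by (intro bexI[of _ "\<lambda>_. 0"]) auto
  next
    case (add f g)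
    then obtain f' g' where "f' \<in> smooth_algebra" "g' \<in> smooth_algebra"
      "\<And>x. (f has_field_derivative f' x) (at x)" "\<And>x. (g has_field_derivative g' x) (at x)" by blast
    then show ?case
      by (intro bexI[of _ "\<lambda>x. f' x + g' x"] allI DERIV_add smooth_algebra.add) simp_all
  next
    case (mult f g)
    then obtain f' g' where "f' \<in> smooth_algebra" "g' \<in> smooth_algebra"
      "\<And>x. (f has_field_derivative f' x) (at x)" "\<And>x. (g has_field_derivative g' x) (at x)" by blast
    then show ?case using mult.hyps
      by (intro bexI[of _ "\<lambda>x. f' x * g x + g' x * f x"] allI DERIV_mult
          smooth_algebra.add smooth_algebra.mult) simp_all
  qed
qed

text \<open>All derivatives of exp (-1/x), extended by 0 to x \<le> 0, have this form for some
  polynomial p, so the family is closed under differentiation.\<close>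

definition bump_tail :: "real poly \<Rightarrow> real \<Rightarrow> real" where
  "bump_tail p x = (if 0 < x then poly p (1 / x) * exp (- (1 / x)) else 0)"

lemma tendsto_poly_times_exp: "((\<lambda>x. poly p x * exp (- x)) \<longlongrightarrow> (0::real)) at_top"
proof -
  have "((\<lambda>x. \<Sum>i\<le>degree p. coeff p i * (x ^ i / exp x)) \<longlongrightarrow> (\<Sum>i\<le>degree p. coeff p i * 0)) at_top"
    by (intro tendsto_intros tendsto_power_div_exp_0)
  moreover have "(\<Sum>i\<le>degree p. coeff p i * (x ^ i / exp x)) = poly p x * exp (- x)" for x
    by (simp add: poly_altdef sum_distrib_right exp_minus divide_inverse mult.assoc)
  ultimately show ?thesis by simp
qed

lemma bump_tail_DERIV:
  "(bump_tail p has_field_derivative bump_tail ([:0, 0, 1:] * (p - pderiv p)) x) (at x)"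
proof -
  consider "x > 0" | "x < 0" | "x = 0" by linarith
  then show ?thesis
  proof cases
    case 1
    have "((\<lambda>x. poly p (1 / x) * exp (- (1 / x))) has_field_derivative
        bump_tail ([:0, 0, 1:] * (p - pderiv p)) x) (at x)"
    proof (rule DERIV_cong)
      have inv: "((\<lambda>x. 1 / x) has_field_derivative - (1 / x\<^sup>2)) (at x)"
        using 1 by (auto intro!: derivative_eq_intros simp: power2_eq_square)
      show "((\<lambda>x. poly p (1 / x) * exp (- (1 / x))) has_field_derivative
          poly (pderiv p) (1 / x) * - (1 / x\<^sup>2) * exp (- (1 / x))
          + exp (- (1 / x)) * - (- (1 / x\<^sup>2)) * poly p (1 / x)) (at x)"
        by (intro DERIV_mult DERIV_chain2[OF poly_DERIV inv] DERIV_chain2[OF DERIV_exp DERIV_minus[OF inv]])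
      show "poly (pderiv p) (1 / x) * - (1 / x\<^sup>2) * exp (- (1 / x))
          + exp (- (1 / x)) * - (- (1 / x\<^sup>2)) * poly p (1 / x)
          = bump_tail ([:0, 0, 1:] * (p - pderiv p)) x"
        using 1 by (simp add: bump_tail_def power2_eq_square algebra_simps)
    qed
    moreover have "eventually (\<lambda>y. bump_tail p y = poly p (1 / y) * exp (- (1 / y))) (nhds x)"
      using eventually_nhds_in_open[OF open_greaterThan, of x 0] 1 
      by (auto elim!: eventually_mono simp: bump_tail_def)
    ultimately show ?thesis by (subst DERIV_cong_ev[OF refl _ refl]) auto
  next
    case 2
    have "eventually (\<lambda>y. bump_tail p y = 0) (nhds x)"
      using eventually_nhds_in_open[OF open_lessThan, of x 0] 2
      by (auto elim!: eventually_mono simp: bump_tail_def)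
    then show ?thesis using 2 by (subst DERIV_cong_ev[OF refl _ refl]) (auto simp: bump_tail_def)
  next
    case 3
    have "((\<lambda>h. bump_tail p h / h) \<longlongrightarrow> 0) (at 0)"
      unfolding filterlim_at_split
    proof
      show "((\<lambda>h. bump_tail p h / h) \<longlongrightarrow> 0) (at_left 0)"
        by (rule tendsto_eventually) (auto simp: eventually_at_filter bump_tail_def)
      \<comment> \<open>Dividing by h multiplies the polynomial in 1/h by its variable, hence
        \<open>pCons 0 p\<close>; the exponential still dominates.\<close>
      have "((\<lambda>h. poly (pCons 0 p) (inverse h) * exp (- inverse h)) \<longlongrightarrow> 0) (at_right (0::real))"
        by (rule filterlim_compose[OF tendsto_poly_times_exp filterlim_inverse_at_top_right])
      moreover have "eventually (\<lambda>h. poly (pCons 0 p) (inverse h) * exp (- inverse h) = bump_tail p h / h) (at_right 0)"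
        by (auto simp: eventually_at_filter bump_tail_def field_simps)
      ultimately show "((\<lambda>h. bump_tail p h / h) \<longlongrightarrow> 0) (at_right 0)"
        by (rule Lim_transform_eventually)
    qed
    then show ?thesis using 3 by (simp add: DERIV_def bump_tail_def)
  qed
qed

lemma smooth_bump_tail: "smooth (bump_tail p)"
  by (rule smooth_coinduct[of _ "range bump_tail"]) (use bump_tail_DERIV in auto)

text \<open>As n grows, the factors exp (-1 / (n t)) tend to 1 for t > 0, so the bumps approximate
  the indicator of the open interval (c, d) from below.\<close>

definition bump :: "real \<Rightarrow> real \<Rightarrow> nat \<Rightarrow> real \<Rightarrow> real" where
  "bump c d n x = bump_tail 1 (real n * (x - c)) * bump_tail 1 (real n * (d - x))"

lemma smooth_bump: "smooth (bump c d n)"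
proof -
  have "(\<lambda>x. bump_tail 1 (real n * x + - (real n * c)) * bump_tail 1 (- real n * x + real n * d)) \<in> smooth_algebra"
    by (rule smooth_algebra.mult; rule smooth_algebra.base; rule smooth_bump_tail)
  moreover have "bump c d n = (\<lambda>x. bump_tail 1 (real n * x + - (real n * c)) * bump_tail 1 (- real n * x + real n * d))"
    by (auto simp: bump_def algebra_simps)
  ultimately show ?thesis using smooth_algebra_smooth by simp
qed

lemma bump_nonneg: "0 \<le> bump c d n x" and bump_le_1: "bump c d n x \<le> 1"
  by (auto simp: bump_def bump_tail_def intro!: mult_le_one)

lemma bump_eq_0: "x \<le> c \<or> d \<le> x \<Longrightarrow> bump c d n x = 0"
  by (cases "n = 0") (auto simp: bump_def bump_tail_def zero_less_mult_iff)

lemma bump_pos: "x \<in> {c<..<d} \<Longrightarrow> 0 < n \<Longrightarrow> 0 < bump c d n x"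
  by (auto simp: bump_def bump_tail_def)

lemma bump_tendsto: "(\<lambda>n. bump c d n x) \<longlonglongrightarrow> indicat_real {c<..<d} x"
proof (cases "x \<in> {c<..<d}")
  case True
  have "(\<lambda>n. bump_tail 1 (real n * t)) \<longlonglongrightarrow> 1" if "t > 0" for t
  proof (rule Lim_transform_eventually)
    show "(\<lambda>n. exp (- (1 / t) * (1 / real n))) \<longlonglongrightarrow> 1"
      by (rule tendsto_eq_intros lim_1_over_n refl | simp)+
    show "\<forall>\<^sub>F n in sequentially. exp (- (1 / t) * (1 / real n)) = bump_tail 1 (real n * t)"
      using eventually_gt_at_top[of 0]
    proof eventually_elim
      case (elim n)
      then show ?case using that by (simp add: bump_tail_def mult.commute)
    qed
  qed
  from tendsto_mult[OF this[of "x - c"] this[of "d - x"]] True show ?thesis by (simp add: bump_def)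
qed (auto simp: bump_eq_0)

lemma test_function_iff:
  "test_function a b f \<longleftrightarrow> smooth f \<and> (\<exists>c d. a < c \<and> d < b \<and> (\<forall>x. x \<notin> {c..d} \<longrightarrow> f x = 0))"
  if "a < b"
proof
  assume t: "test_function a b f"
  let ?S = "closure {x. f x \<noteq> 0}"
  have S: "compact ?S" "?S \<subseteq> {a<..<b}" using t by (auto simp: test_function_def)
  have "\<exists>c d. a < c \<and> d < b \<and> ?S \<subseteq> {c..d}"
  proof (cases "?S = {}")
    case True
    \<comment> \<open>The zero function has empty support; the bounds are taken in reverse order, so
      that {c..d} is empty as well.\<close>
    then show ?thesis using that by (intro exI[of _ b] exI[of _ a]) auto
  next
    case False
    obtain c where "c \<in> ?S" "\<forall>x\<in>?S. c \<le> x" using compact_attains_inf[OF S(1) False] by blast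
    moreover obtain d where "d \<in> ?S" "\<forall>x\<in>?S. x \<le> d" using compact_attains_sup[OF S(1) False] by blast
    ultimately show ?thesis using S(2) by (intro exI[of _ c] exI[of _ d]) auto
  qed
  then obtain c d where cd: "a < c" "d < b" "?S \<subseteq> {c..d}" by blast
  have "\<forall>x. x \<notin> {c..d} \<longrightarrow> f x = 0"
    using cd(3) closure_subset[of "{x. f x \<noteq> 0}"] by blast
  moreover have "smooth f" using t by (simp add: test_function_def smooth_def)
  ultimately show "smooth f \<and> (\<exists>c d. a < c \<and> d < b \<and> (\<forall>x. x \<notin> {c..d} \<longrightarrow> f x = 0))"
    using cd by blast
next
  assume "smooth f \<and> (\<exists>c d. a < c \<and> d < b \<and> (\<forall>x. x \<notin> {c..d} \<longrightarrow> f x = 0))"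
  then obtain c d where f: "smooth f" "a < c" "d < b" "\<And>x. x \<notin> {c..d} \<Longrightarrow> f x = 0" by blast
  have "closure {x. f x \<noteq> 0} \<subseteq> {c..d}"
  proof (rule closure_minimal)
    show "{x. f x \<noteq> 0} \<subseteq> {c..d}" using f(4) by blast
  qed simp
  then show "test_function a b f"
  proof -
    assume sub: "closure {x. f x \<noteq> 0} \<subseteq> {c..d}"
    then have "compact (closure {x. f x \<noteq> 0})"
      using compact_Int_closed[of "{c..d}" "closure {x. f x \<noteq> 0}"] by (simp add: Int_absorb1)
    moreover have "closure {x. f x \<noteq> 0} \<subseteq> {a<..<b}" using sub f(2,3) by fastforce
    ultimately show "test_function a b f" using f(1) unfolding test_function_def smooth_def by blast
  qed
qed

lemma test_function_bump: "a < c \<Longrightarrow> c < d \<Longrightarrow> d < b \<Longrightarrow> test_function a b (bump c d n)"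
proof -
  assume "a < c" "c < d" "d < b"
  moreover have "bump c d n x = 0" if "x \<notin> {c..d}" for x
    using that by (intro bump_eq_0) auto
  ultimately show ?thesis
    using test_function_iff[of a b "bump c d n"] smooth_bump[of c d n] by (meson less_trans)
qed

lemma test_functionE:
  assumes "test_function a b \<phi>" "a < b"
  obtains c d where "a < c" "d < b" "smooth \<phi>" "\<And>x. x \<notin> {c..d} \<Longrightarrow> \<phi> x = 0"
    "\<And>x. x \<notin> {c..d} \<Longrightarrow> deriv \<phi> x = 0"
proof -
  obtain c d where cd: "a < c" "d < b" "smooth \<phi>" "\<And>x. x \<notin> {c..d} \<Longrightarrow> \<phi> x = 0"
    using assms test_function_iff by blast
  have "deriv \<phi> x = 0" if x: "x \<notin> {c..d}" for x
  proof -
    have "\<forall>\<^sub>F y in nhds x. \<phi> y = 0"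
      using eventually_nhds_in_open[of "- {c..d}" x] x cd(4) by (auto elim!: eventually_mono simp: open_Compl)
    then have "deriv \<phi> x = deriv (\<lambda>_. 0) x" by (intro deriv_cong_ev) auto
    then show ?thesis by simp
  qed
  with cd that show thesis by blast
qed

section \<open>Integration against derivatives of test functions\<close>

lemma smooth_borel_measurable: "smooth f \<Longrightarrow> f \<in> borel_measurable borel"
  using smooth_continuous_on borel_measurable_continuous_onI by blast

lemma test_function_deriv_integrable:
  assumes "test_function a b \<phi>" "a < b"
  shows "integrable lborel (deriv \<phi>)"
proof -
  obtain c d where cd: "smooth \<phi>" "\<And>x. x \<notin> {c..d} \<Longrightarrow> deriv \<phi> x = 0"
    using test_functionE[OF assms] by metis
  have "set_integrable lborel {c..d} (deriv \<phi>)"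
    by (intro borel_integrable_atLeastAtMost' smooth_continuous_on smooth_deriv cd(1))
  moreover have "(\<lambda>x. indicator {c..d} x *\<^sub>R deriv \<phi> x) = deriv \<phi>"
    using cd(2) by (auto simp: indicator_def fun_eq_iff)
  ultimately show ?thesis by (simp add: set_integrable_def)
qed

lemma continuous_support_bounded:
  fixes f :: "real \<Rightarrow> real"
  assumes "continuous_on UNIV f" "\<And>x. x \<notin> {c..d} \<Longrightarrow> f x = 0"
  obtains B where "\<And>x. \<bar>f x\<bar> \<le> B"
proof -
  have "bounded (f ` {c..d})"
    by (intro compact_imp_bounded compact_continuous_image continuous_on_subset[OF assms(1)]) auto
  then obtain B where "\<And>x. x \<in> {c..d} \<Longrightarrow> \<bar>f x\<bar> \<le> B" by (fastforce simp: bounded_iff)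
  then have "\<bar>f x\<bar> \<le> max B 0" for x
    using assms(2)[of x] by (cases "x \<in> {c..d}") (auto intro: max.coboundedI1)
  then show thesis using that by blast
qed

lemma test_function_bounded:
  assumes "test_function a b \<phi>" "a < b"
  obtains B where "\<And>x. \<bar>\<phi> x\<bar> \<le> B" "\<And>x. \<bar>deriv \<phi> x\<bar> \<le> B"
proof -
  obtain c d where cd: "smooth \<phi>" "\<And>x. x \<notin> {c..d} \<Longrightarrow> \<phi> x = 0" "\<And>x. x \<notin> {c..d} \<Longrightarrow> deriv \<phi> x = 0"
    using test_functionE[OF assms] by metis
  obtain B1 where "\<And>x. \<bar>\<phi> x\<bar> \<le> B1" using continuous_support_bounded[OF smooth_continuous_on[OF cd(1)] cd(2)] by blast
  moreover obtain B2 where "\<And>x. \<bar>deriv \<phi> x\<bar> \<le> B2"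
    using continuous_support_bounded[OF smooth_continuous_on[OF smooth_deriv[OF cd(1)]] cd(3)] by blast
  ultimately show thesis by (intro that[of "max B1 B2"]) (auto simp: le_max_iff_disj)
qed

lemma test_function_tail_integral:
  assumes "test_function a b \<phi>" "a < b"
  shows "(LBINT t. (if x < t then deriv \<phi> t else 0)) = - \<phi> x"
proof -
  obtain c d where cd: "smooth \<phi>" "\<And>x. x \<notin> {c..d} \<Longrightarrow> \<phi> x = 0" "\<And>x. x \<notin> {c..d} \<Longrightarrow> deriv \<phi> x = 0"
    using test_functionE[OF assms] by metis
  define e where "e = max x d + 1"
  have e: "x \<le> e" "d < e" by (auto simp: e_def)
  have "has_bochner_integral lborel (\<lambda>t. indicator {x..e} t *\<^sub>R deriv \<phi> t) (\<phi> e - \<phi> x)"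
  proof (rule has_bochner_integral_FTC_Icc[OF e(1)])
    show "(\<phi> has_vector_derivative deriv \<phi> t) (at t within {x..e})" for t
      using smooth_DERIV[OF cd(1), of t]
      by (simp add: has_real_derivative_iff_has_vector_derivative has_vector_derivative_at_within)
  qed (intro smooth_continuous_on smooth_deriv cd(1))
  then have "(LBINT t. indicator {x..e} t *\<^sub>R deriv \<phi> t) = \<phi> e - \<phi> x"
    by (rule has_bochner_integral_integral_eq)
  moreover have "(LBINT t. indicator {x..e} t *\<^sub>R deriv \<phi> t) = (LBINT t. (if x < t then deriv \<phi> t else 0))"
  proof (rule integral_cong_AE)
    have [measurable]: "deriv \<phi> \<in> borel_measurable borel"
      by (intro smooth_borel_measurable smooth_deriv cd(1))
    show "(\<lambda>t. indicator {x..e} t *\<^sub>R deriv \<phi> t) \<in> borel_measurable lborel" by measurable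
    show "(\<lambda>t. if x < t then deriv \<phi> t else 0) \<in> borel_measurable lborel" by measurable
    show "AE t in lborel. indicator {x..e} t *\<^sub>R deriv \<phi> t = (if x < t then deriv \<phi> t else 0)"
      using AE_lborel_singleton[of x] by eventually_elim (use cd(3) e in \<open>auto simp: indicator_def\<close>)
  qed
  moreover have "\<phi> e = 0" using e by (intro cd(2)) auto
  ultimately show ?thesis by simp
qed

text \<open>A finite measure on \<open>(a,b)\<close>, extended by zero to the Borel sets of the line.\<close>
definition fin_borel_on :: "real \<Rightarrow> real \<Rightarrow> real measure \<Rightarrow> bool" where
  "fin_borel_on a b P \<longleftrightarrow> finite_measure P \<and> sets P = sets borel \<and> measure P (- {a<..<b}) = 0"

lemma fin_borel_onD:
  assumes "fin_borel_on a b P"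
  shows "finite_measure P" "sets P = sets borel" "space P = UNIV"
    "A \<in> sets borel \<Longrightarrow> measure P (A \<inter> {a<..<b}) = measure P A"
    "AE x in P. x \<in> {a<..<b}"
proof -
  show fin: "finite_measure P" and s: "sets P = sets borel" using assms by (auto simp: fin_borel_on_def)
  interpret finite_measure P by fact
  show sp: "space P = UNIV" using sets_eq_imp_space_eq[OF s] by simp
  have "- {a<..<b} \<in> null_sets P"
    using assms s by (auto simp: fin_borel_on_def null_sets_def emeasure_eq_measure)
  then show ae: "AE x in P. x \<in> {a<..<b}" by (auto dest: AE_not_in)
  show "measure P (A \<inter> {a<..<b}) = measure P A" if "A \<in> sets borel"
  proof (rule measure_eq_AE)
    show "AE x in P. (x \<in> A \<inter> {a<..<b}) = (x \<in> A)" using ae by eventually_elim simp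
    show "A \<inter> {a<..<b} \<in> sets P" "A \<in> sets P" unfolding s using that by (rule sets.Int[OF _ borel_open]) (simp, rule that)
  qed
qed

lemma cdf_measurable:
  fixes P :: "real measure"
  assumes "finite_measure P" "sets P = sets borel"
  shows "(\<lambda>t. measure P {..<t}) \<in> borel_measurable borel"
proof (rule borel_measurable_mono)
  show "mono (\<lambda>t. measure P {..<t})"
  proof (rule monoI)
    fix x y :: real assume "x \<le> y"
    then show "measure P {..<x} \<le> measure P {..<y}"
      using finite_measure.finite_measure_mono[OF assms(1), of "{..<x}" "{..<y}"] assms(2) by simp
  qed
qed

text \<open>Integration by parts through Fubini, for the function that equals
  \<open>deriv \<phi> t\<close> where x < t and 0 elsewhere: integrating over x first produces the
  distribution function, integrating over t first produces -\<phi> x.\<close>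

lemma integral_cdf_deriv:
  assumes P: "finite_measure P" "sets P = sets borel" and t: "test_function a b \<phi>" "a < b"
  shows "(LBINT t. measure P {..<t} * deriv \<phi> t) = - (LINT x|P. \<phi> x)"
proof -
  interpret P: finite_measure P by fact
  interpret pair_sigma_finite P lborel ..
  obtain c d where sm: "smooth \<phi>" using test_functionE[OF t] by metis
  have [measurable_cong]: "sets P = sets borel" by fact
  have spP: "space P = UNIV" using sets_eq_imp_space_eq[OF P(2)] by simp
  have [measurable]: "deriv \<phi> \<in> borel_measurable borel"
    by (intro smooth_borel_measurable smooth_deriv sm)
  have int: "integrable lborel (\<lambda>t. if x < t then deriv \<phi> t else 0)" for x
    by (rule Bochner_Integration.integrable_bound[OF test_function_deriv_integrable[OF t]]) auto
  have "integrable (P \<Otimes>\<^sub>M lborel) (\<lambda>(x, t). if x < t then deriv \<phi> t else 0)"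
  proof (rule Fubini_integrable)
    show "(\<lambda>(x, t). if x < t then deriv \<phi> t else 0) \<in> borel_measurable (P \<Otimes>\<^sub>M lborel)"
      by measurable
    show "AE x in P. integrable lborel (\<lambda>t. case (x, t) of (x, t) \<Rightarrow> if x < t then deriv \<phi> t else 0)"
      using int by simp
    show "integrable P (\<lambda>x. LBINT t. norm (case (x, t) of (x, t) \<Rightarrow> if x < t then deriv \<phi> t else 0))"
    proof (rule P.integrable_const_bound)
      show "AE x in P. norm (LBINT t. norm (case (x, t) of (x, t) \<Rightarrow> if x < t then deriv \<phi> t else 0))
          \<le> (LBINT t. norm (deriv \<phi> t))"
      proof (intro AE_I2)
        fix x
        have "(LBINT t. norm (if x < t then deriv \<phi> t else 0)) \<le> (LBINT t. norm (deriv \<phi> t))"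
          by (intro integral_mono integrable_norm int test_function_deriv_integrable[OF t]) auto
        moreover have "(LBINT t. norm (if x < t then deriv \<phi> t else 0)) \<ge> 0" by simp
        ultimately show "norm (LBINT t. norm (case (x, t) of (x, t) \<Rightarrow> if x < t then deriv \<phi> t else 0))
          \<le> (LBINT t. norm (deriv \<phi> t))" by simp
      qed
    qed measurable
  qed
  then have "(LBINT t. (LINT x|P. (if x < t then deriv \<phi> t else 0))) = (LINT x|P. (LBINT t. (if x < t then deriv \<phi> t else 0)))"
    by (rule Fubini_integral)
  moreover have "(LINT x|P. (if x < t then deriv \<phi> t else 0)) = measure P {..<t} * deriv \<phi> t" for t
  proof -
    have "(LINT x|P. (if x < t then deriv \<phi> t else 0)) = (LINT x|P. indicator {..<t} x * deriv \<phi> t)"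
      by (intro Bochner_Integration.integral_cong) (auto simp: indicator_def)
    then show ?thesis using spP by simp
  qed
  ultimately show ?thesis by (simp add: test_function_tail_integral[OF t])
qed

lemma integral_test_deriv: "test_function a b \<phi> \<Longrightarrow> a < b \<Longrightarrow> (LBINT t. deriv \<phi> t) = 0"
proof -
  assume t: "test_function a b \<phi>" "a < b"
  obtain c d where cd: "\<And>x. x \<notin> {c..d} \<Longrightarrow> \<phi> x = 0" "\<And>x. x \<notin> {c..d} \<Longrightarrow> deriv \<phi> x = 0"
    using test_functionE[OF t] by metis
  have "(\<lambda>t. if c - 1 < t then deriv \<phi> t else 0) = deriv \<phi>"
    using cd(2) by (auto simp: fun_eq_iff)
  then show ?thesis using test_function_tail_integral[OF t, of "c - 1"] cd(1)[of "c - 1"] by simp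
qed

text \<open>Mean zero is what makes the primitive that vanishes to the left of the support vanish to
  the right of it too.\<close>

lemma ex_test_antiderivative:
  assumes g: "smooth g" "\<And>x. x \<notin> {c..d} \<Longrightarrow> g x = 0" "(LBINT x. g x) = 0" and cd: "a < c" "c < d" "d < b"
  obtains \<phi> where "test_function a b \<phi>" "deriv \<phi> = g"
proof -
  have cont: "continuous_on UNIV g" using g(1) by (rule smooth_continuous_on)
  obtain F where F: "\<And>x. (F has_vector_derivative g x) (at x)"
    using einterval_antiderivative[of "-\<infinity>" "\<infinity>" g] cont by (auto simp: continuous_on_eq_continuous_at)
  define \<phi> where "\<phi> = (\<lambda>x. F x - F c)"
  have D: "(\<phi> has_field_derivative g x) (at x)" for x
    unfolding \<phi>_def using F[of x] by (auto intro!: derivative_eq_intros simp: has_real_derivative_iff_has_vector_derivative)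
  then have dphi: "deriv \<phi> = g" by (auto intro!: DERIV_imp_deriv)
  have FTC: "(LBINT t. indicator {x..y} t *\<^sub>R g t) = F y - F x" if "x \<le> y" for x y
    by (intro has_bochner_integral_integral_eq has_bochner_integral_FTC_Icc that continuous_on_subset[OF cont])
      (use F in \<open>auto simp: has_vector_derivative_at_within\<close>)
  have "\<phi> x = 0" if "x \<notin> {c..d}" for x
  proof (cases "x < c")
    case True
    \<comment> \<open>The hypothesis on the support is silent about the end point c itself;
      continuity gives the value there.\<close>
    have "g c = 0"
    proof -
      have "(g \<longlongrightarrow> g c) (at_left c)" using cont by (auto simp: continuous_on_def intro: tendsto_within_subset)
      moreover have "(g \<longlongrightarrow> 0) (at_left c)"
        by (rule tendsto_eventually) (use g(2) in \<open>auto simp: eventually_at_filter\<close>)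
      ultimately show ?thesis using tendsto_unique trivial_limit_at_left_real by blast
    qed
    then have "indicator {x..c} t *\<^sub>R g t = 0" for t
      using g(2)[of t] by (cases "t = c") (auto simp: indicator_def)
    then have "(\<lambda>t. indicator {x..c} t *\<^sub>R g t) = (\<lambda>t. 0)" by (rule ext)
    then have "(LBINT t. indicator {x..c} t *\<^sub>R g t) = 0" by (simp only:) simp
    then show ?thesis using FTC[of x c] True by (simp add: \<phi>_def)
  next
    case False
    with that have x: "d < x" "c \<le> x" by simp_all
    have "indicator {c..x} t *\<^sub>R g t = g t" for t
      using g(2)[of t] x by (cases "t \<in> {c..d}") auto
    then have "(\<lambda>t. indicator {c..x} t *\<^sub>R g t) = g" by (rule ext)
    then show ?thesis using FTC[of c x] \<open>c \<le> x\<close> g(3) by (simp add: \<phi>_def)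
  qed
  moreover have "smooth \<phi>"
  proof -
    have "\<phi> differentiable_on UNIV" using D by (auto simp: differentiable_on_def real_differentiable_def)
    then show ?thesis using g(1) smooth_iff[of \<phi>] dphi by simp
  qed
  ultimately have "test_function a b \<phi>" using cd test_function_iff[of a b \<phi>] by (meson less_trans)
  with dphi that show thesis by blast
qed

section \<open>Distributional derivatives\<close>

lemma fin_borel_onI:
  assumes "finite_measure P" "sets P = sets borel" "AE x in P. x \<in> {a<..<b}"
  shows "fin_borel_on a b P"
proof -
  interpret finite_measure P by fact
  have "- {a<..<b} \<in> sets P" by (simp add: assms(2))
  moreover have "AE x in P. x \<notin> - {a<..<b}" using assms(3) by simp
  ultimately have "- {a<..<b} \<in> null_sets P" using AE_iff_null_sets by blast
  then have "measure P (- {a<..<b}) = 0" by (simp add: null_sets_def measure_def)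
  then show ?thesis using assms by (simp add: fin_borel_on_def)
qed

lemma bump_integral_tendsto:
  assumes "finite_measure P" "sets P = sets borel"
  shows "(\<lambda>n. LINT x|P. bump c d n x) \<longlonglongrightarrow> measure P {c<..<d}"
proof -
  interpret finite_measure P by fact
  have [measurable_cong]: "sets P = sets borel" by fact
  have [measurable]: "bump c d n \<in> borel_measurable borel" for n
    by (intro smooth_borel_measurable smooth_bump)
  have "(\<lambda>n. LINT x|P. bump c d n x) \<longlonglongrightarrow> (LINT x|P. indicat_real {c<..<d} x)"
  proof (rule integral_dominated_convergence[where w = "\<lambda>_. 1"])
    show "AE x in P. (\<lambda>n. bump c d n x) \<longlonglongrightarrow> indicat_real {c<..<d} x" by (simp add: bump_tendsto)
    show "AE x in P. norm (bump c d n x) \<le> 1" for n by (simp add: bump_nonneg bump_le_1)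
  qed auto
  then show ?thesis using assms(2) by simp
qed

text \<open>The difference G of the two signed measures vanishes on open intervals compactly inside
  (a, b), because bumps converge to their indicators. Monotone limits carry this to half-lines,
  which generate the Borel sets and are stable under intersection.\<close>

lemma signed_measure_unique:
  assumes ab: "a < b" and fin: "fin_borel_on a b P1" "fin_borel_on a b N1" "fin_borel_on a b P2" "fin_borel_on a b N2"
    and eq: "\<And>\<phi>. test_function a b \<phi> \<Longrightarrow>
      (LINT x|P1. \<phi> x) - (LINT x|N1. \<phi> x) = (LINT x|P2. \<phi> x) - (LINT x|N2. \<phi> x)"
    and A: "A \<in> sets borel"
  shows "measure P1 A - measure N1 A = measure P2 A - measure N2 A"
proof -
  define \<M> where "\<M> = {P1, N1, P2, N2}"
  have M: "finite_measure M" "sets M = sets borel" "space M = UNIV"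
    "\<And>A. A \<in> sets borel \<Longrightarrow> measure M (A \<inter> {a<..<b}) = measure M A" if "M \<in> \<M>" for M
    using that fin_borel_onD[of a b] fin unfolding \<M>_def by blast+
  define G where "G = (\<lambda>A. measure P1 A - measure N1 A - (measure P2 A - measure N2 A))"
  have G_lim: "(\<lambda>n. G (S n)) \<longlonglongrightarrow> G (\<Union>n. S n)" if "range S \<subseteq> sets borel" "incseq S" for S
    unfolding G_def using that M
    by (intro tendsto_diff finite_measure.finite_Lim_measure_incseq) (auto simp: \<M>_def)
  have G_Int: "G (A \<inter> {a<..<b}) = G A" if "A \<in> sets borel" for A
    unfolding G_def using M(4)[OF _ that] by (simp add: \<M>_def)
  have G1: "G {c<..<d} = 0" if "a < c" "c < d" "d < b" for c d
  proof -
    have "(\<lambda>n. (LINT x|P1. bump c d n x) - (LINT x|N1. bump c d n x)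
        - ((LINT x|P2. bump c d n x) - (LINT x|N2. bump c d n x))) \<longlonglongrightarrow> G {c<..<d}"
      unfolding G_def using M by (intro tendsto_diff bump_integral_tendsto) (auto simp: \<M>_def)
    then show ?thesis using eq[OF test_function_bump[OF that]] by (simp add: LIMSEQ_const_iff)
  qed
  have G2: "G {c<..<b} = 0" if c: "a \<le> c" "c < b" for c
  proof -
    \<comment> \<open>The summand 3 keeps e n below (b - c) / 2 already for n = 0, so that no
      interval in the exhaustion is empty.\<close>
    define e where "e n = (b - c) / real (n + 3)" for n :: nat
    have e: "0 < e n" "e n < (b - c) / 2" for n
      unfolding e_def using c by (simp, intro divide_strict_left_mono, auto)
    have elim: "e \<longlonglongrightarrow> 0" unfolding e_def
      by (intro real_tendsto_divide_at_top[OF tendsto_const]) (rule filterlim_real_sequentially[THEN filterlim_compose], rule filterlim_add_const_nat_at_top)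
    have "(\<Union>n. {c + e n<..<b - e n}) = {c<..<b}"
    proof (intro equalityI subsetI)
      fix x assume x: "x \<in> {c<..<b}"
      have "eventually (\<lambda>n. e n < min (x - c) (b - x)) sequentially"
        using elim x by (intro order_tendstoD(2)) auto
      then obtain n where "e n < min (x - c) (b - x)" by (auto simp: eventually_sequentially)
      then show "x \<in> (\<Union>n. {c + e n<..<b - e n})" by (auto intro!: exI[of _ n])
    next
      fix x assume "x \<in> (\<Union>n. {c + e n<..<b - e n})"
      then obtain n where "c + e n < x" "x < b - e n" by auto
      then show "x \<in> {c<..<b}" using e(1)[of n] by simp
    qed
    moreover have "e n \<le> e m" if "m \<le> n" for m n
      unfolding e_def using that c by (intro divide_left_mono) auto
    then have "incseq (\<lambda>n. {c + e n<..<b - e n})"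
      by (intro monoI) (fastforce intro: less_le_trans le_less_trans simp: subset_iff)
    ultimately have "(\<lambda>n. G {c + e n<..<b - e n}) \<longlonglongrightarrow> G {c<..<b}"
      using G_lim[of "\<lambda>n. {c + e n<..<b - e n}"] by fastforce
    moreover have "G {c + e n<..<b - e n} = 0" for n
    proof (rule G1)
      show "a < c + e n" "b - e n < b" "c + e n < b - e n" using c e[of n] by argo+
    qed
    ultimately show ?thesis by (simp add: LIMSEQ_const_iff)
  qed
  have G3: "G {x<..} = 0" for x
  proof (cases "b \<le> x")
    case True
    then have "{x<..} \<inter> {a<..<b} = {}" by auto
    then show ?thesis using G_Int[of "{x<..}"] by (simp add: G_def)
  next
    case False
    then have "{x<..} \<inter> {a<..<b} = {max a x<..<b}" by auto
    then show ?thesis using G_Int[of "{x<..}"] G2[of "max a x"] False ab by simp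
  qed
  have G_UNIV: "G UNIV = 0"
  proof -
    have "UNIV \<inter> {a<..<b} = {a - 1<..} \<inter> {a<..<b}" by auto
    then show ?thesis using G_Int[of UNIV] G_Int[of "{a - 1<..}"] G3[of "a - 1"] by simp
  qed
  have sig: "sets (borel :: real measure) = sigma_sets UNIV (range (\<lambda>x. {x<..}))"
    by (subst borel_Ioi) (simp add: sets_measure_of)
  have "Int_stable (range (\<lambda>x::real. {x<..}))"
  proof -
    have "{x<..} \<inter> {y<..} = {max x y<..}" for x y :: real by auto
    then show ?thesis by (auto simp: Int_stable_def)
  qed
  moreover have "range (\<lambda>x::real. {x<..}) \<subseteq> Pow UNIV" by simp
  moreover have "A \<in> sigma_sets UNIV (range (\<lambda>x. {x<..}))" using A sig by simp
  \<comment> \<open>Dynkin induction is carried out on G itself: it takes both signs, so uniqueness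
    of measures does not apply directly.\<close>
  ultimately have "G A = 0"
  proof (induction rule: sigma_sets_induct_disjoint)
    case (basic A)
    then show ?case using G3 by auto
  next
    case empty
    show ?case by (simp add: G_def)
  next
    case (compl A)
    then have A: "A \<in> sets borel" using sig by simp
    have "measure M (UNIV - A) = measure M UNIV - measure M A" if "M \<in> \<M>" for M
      using finite_measure.finite_measure_compl[OF M(1)[OF that], of A] M[OF that] A by simp
    then have "G (UNIV - A) = G UNIV - G A" by (simp add: G_def \<M>_def)
    then show ?case using compl G_UNIV by simp
  next
    case (union S)
    then have S: "range S \<subseteq> sets borel" using sig by simp
    have "(\<lambda>i. measure M (S i)) sums measure M (\<Union>i. S i)" if "M \<in> \<M>" for M
      by (rule finite_measure.finite_measure_UNION[OF M(1)[OF that]]) (use S M(2)[OF that] union(1) in auto)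
    then have "(\<lambda>i. G (S i)) sums G (\<Union>i. S i)"
      unfolding G_def by (intro sums_diff) (auto simp: \<M>_def)
    then show ?case using union(3) by (simp add: sums_0 sums_unique2)
  qed
  then show ?thesis by (simp add: G_def)
qed

section \<open>Functions with vanishing distributional derivative\<close>

lemma bump_integrable: "integrable lborel (bump c d n)"
proof -
  have "set_integrable lborel {c..d} (bump c d n)"
    by (intro borel_integrable_atLeastAtMost' smooth_continuous_on smooth_bump)
  moreover have "indicator {c..d} x *\<^sub>R bump c d n x = bump c d n x" for x
    using bump_eq_0[of x c d n] by (cases "x \<in> {c..d}") auto
  then have "(\<lambda>x. indicator {c..d} x *\<^sub>R bump c d n x) = bump c d n" by (rule ext)
  ultimately show ?thesis by (simp add: set_integrable_def)
qed

lemma bump_integral_pos: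
  assumes "c < d" "0 < n"
  shows "0 < (LBINT x. bump c d n x)"
proof (rule ccontr)
  assume "\<not> 0 < (LBINT x. bump c d n x)"
  moreover have "0 \<le> (LBINT x. bump c d n x)" by (intro integral_nonneg_AE) (simp add: bump_nonneg)
  ultimately have "(LBINT x. bump c d n x) = 0" by linarith
  then have "AE x in lborel. bump c d n x = 0"
    using integral_nonneg_eq_0_iff_AE[OF bump_integrable[of c d n]] bump_nonneg by blast
  then have "AE x in lborel. x \<notin> {c<..<d}"
  proof eventually_elim
    case (elim x)
    then show ?case using bump_pos[of x c d n] assms(2) by auto
  qed
  then have "{c<..<d} \<in> null_sets lborel" using AE_iff_null_sets[of "{c<..<d}" lborel] by simp
  then show False using assms(1) by (simp add: null_sets_def)
qed

text \<open>Subtracting from a test function \<psi> the multiple of a fixed bump \<eta> with the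
  same integral leaves mean zero, hence the derivative of a test function. So w - k, with k the mean
  of w weighted by \<eta>, is orthogonal to every \<psi> and not only to derivatives.\<close>

lemma du_Bois_Reymond:
  assumes ab: "a < b" and w: "integrable lborel w"
    and orth: "\<And>\<phi>. test_function a b \<phi> \<Longrightarrow> (LBINT x. w x * deriv \<phi> x) = 0"
  obtains k :: real where "AE x in lborel. x \<in> {a<..<b} \<longrightarrow> w x = k"
proof -
  have wm [measurable]: "w \<in> borel_measurable borel" using w by auto
  define c0 where "c0 = (2 * a + b) / 3"
  define d0 where "d0 = (a + 2 * b) / 3"
  have cd0: "a < c0" "c0 < d0" "d0 < b" using ab by (auto simp: c0_def d0_def)
  define \<eta> where "\<eta> = bump c0 d0 1"
  define I where "I = (LBINT x. \<eta> x)"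
  have I: "I > 0" unfolding I_def \<eta>_def by (rule bump_integral_pos) (use cd0 in auto)
  define k where "k = (LBINT x. w x * \<eta> x) / I"
  have mult_int: "integrable lborel (\<lambda>x. w x * f x)" if "f \<in> borel_measurable borel" "\<And>x. \<bar>f x\<bar> \<le> B" for f B
  proof (rule Bochner_Integration.integrable_bound[where f = "\<lambda>x. B * w x"])
    show "AE x in lborel. norm (w x * f x) \<le> norm (B * w x)"
    proof (intro AE_I2)
      fix x
      have "\<bar>f x\<bar> \<le> \<bar>B\<bar>" using that(2)[of x] by linarith
      then have "\<bar>w x\<bar> * \<bar>f x\<bar> \<le> \<bar>w x\<bar> * \<bar>B\<bar>" by (intro mult_left_mono) auto
      then show "norm (w x * f x) \<le> norm (B * w x)" by (simp add: abs_mult mult.commute)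
    qed
  qed (use w that(1) in auto)
  have \<eta>: "smooth \<eta>" "integrable lborel \<eta>" "integrable lborel (\<lambda>x. w x * \<eta> x)"
    unfolding \<eta>_def by (auto intro!: smooth_bump bump_integrable mult_int[of _ 1] smooth_borel_measurable simp: bump_nonneg bump_le_1)
  have key: "(LBINT x. w x * \<psi> x) = k * (LBINT x. \<psi> x)" "integrable lborel \<psi>" "integrable lborel (\<lambda>x. w x * \<psi> x)"
    if \<psi>: "test_function a b \<psi>" for \<psi>
  proof -
    obtain c d where cd: "a < c" "d < b" "smooth \<psi>" "\<And>x. x \<notin> {c..d} \<Longrightarrow> \<psi> x = 0"
      using test_functionE[OF \<psi> ab] by metis
    obtain B where B: "\<And>x. \<bar>\<psi> x\<bar> \<le> B" using test_function_bounded[OF \<psi> ab] by metis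
    have m: "\<psi> \<in> borel_measurable borel" using cd(3) by (rule smooth_borel_measurable)
    have "set_integrable lborel {c..d} \<psi>"
      by (intro borel_integrable_atLeastAtMost' smooth_continuous_on cd(3))
    moreover have "(\<lambda>x. indicator {c..d} x *\<^sub>R \<psi> x) = \<psi>"
      using cd(4) by (auto simp: indicator_def fun_eq_iff)
    ultimately show int: "integrable lborel \<psi>" by (simp add: set_integrable_def)
    show int2: "integrable lborel (\<lambda>x. w x * \<psi> x)" using mult_int[OF m B] .
    define r where "r = (LBINT x. \<psi> x) / I"
    define g where "g = (\<lambda>x. \<psi> x + (- r) * \<eta> x)"
    have "(\<lambda>x. \<psi> (1 * x + 0) + (\<lambda>_. - r) x * \<eta> (1 * x + 0)) \<in> smooth_algebra"
      by (rule smooth_algebra.add; (rule smooth_algebra.mult)?; (rule smooth_algebra.const smooth_algebra.base)) (rule cd(3) \<eta>(1))+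
    then have "smooth g" unfolding g_def by (auto dest: smooth_algebra_smooth)
    moreover have "(LBINT x. g x) = 0" unfolding g_def using int \<eta> I by (simp add: r_def I_def[symmetric])
    moreover have "g x = 0" if "x \<notin> {min c c0..max d d0}" for x
    proof -
      have "x \<notin> {c..d}" "x \<le> c0 \<or> d0 \<le> x" using that by auto
      then show ?thesis using cd(4)[of x] bump_eq_0[of x c0 d0 1] by (simp add: g_def \<eta>_def)
    qed
    ultimately obtain \<phi> where "test_function a b \<phi>" "deriv \<phi> = g"
    proof -
      assume that: "\<And>\<phi>. test_function a b \<phi> \<Longrightarrow> deriv \<phi> = g \<Longrightarrow> thesis"
        and g: "smooth g" "(LBINT x. g x) = 0" "\<And>x. x \<notin> {min c c0..max d d0} \<Longrightarrow> g x = 0"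
      have "a < min c c0" "min c c0 < max d d0" "max d d0 < b" using cd cd0 by auto
      then show thesis using ex_test_antiderivative[OF g(1,3,2)] that by metis
    qed
    then have "0 = (LBINT x. w x * g x)" using orth by metis
    also have "\<dots> = (LBINT x. w x * \<psi> x + (- r) * (w x * \<eta> x))"
      by (simp add: g_def algebra_simps)
    also have "\<dots> = (LBINT x. w x * \<psi> x) - r * (LBINT x. w x * \<eta> x)"
      using int2 \<eta>(3) by simp
    finally show "(LBINT x. w x * \<psi> x) = k * (LBINT x. \<psi> x)" by (simp add: k_def r_def)
  qed
  define z where "z = (\<lambda>x. indicator {a<..<b} x * (w x - k))"
  have zm [measurable]: "z \<in> borel_measurable borel" unfolding z_def by measurable
  have zi: "integrable lborel z"
    unfolding z_def right_diff_distrib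
    using w by (intro Bochner_Integration.integrable_diff integrable_mult_indicator[of _ lborel w, simplified])
      (use ab in \<open>auto intro!: integrable_mult_left integrable_real_indicator simp: emeasure_lborel_Ioo\<close>)
  \<comment> \<open>For s = 1 and s = -1 these measures have the positive and the negative part of z
    as densities; by orthogonality no test function distinguishes them.\<close>
  define M where "M s = density lborel (\<lambda>x. ennreal (max 0 (s * z x)))" for s :: real
  have M_fin: "fin_borel_on a b (M s)" for s
  proof (rule fin_borel_onI)
    have "integrable lborel (\<lambda>x. max 0 (s * z x))" using zi by simp
    then have "(\<integral>\<^sup>+x. ennreal (max 0 (s * z x)) \<partial>lborel) < \<infinity>"
      by (subst nn_integral_eq_integral) auto
    then show "finite_measure (M s)"
      by (intro finite_measureI) (simp add: M_def emeasure_density)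
    show "sets (M s) = sets borel" by (simp add: M_def)
    show "AE x in M s. x \<in> {a<..<b}"
      unfolding M_def by (subst AE_density) (auto simp: z_def indicator_def)
  qed
  have M_int: "(LINT x|M 1. \<psi> x) - (LINT x|M (- 1). \<psi> x) = 0" if \<psi>: "test_function a b \<psi>" for \<psi>
  proof -
    have sm: "smooth \<psi>" using test_functionE[OF \<psi> ab] by metis
    have m [measurable]: "\<psi> \<in> borel_measurable borel" by (rule smooth_borel_measurable[OF sm])
    obtain B where B: "\<And>x. \<bar>\<psi> x\<bar> \<le> B" using test_function_bounded[OF \<psi> ab] by metis
    have d: "(LINT x|M s. \<psi> x) = (LBINT x. max 0 (s * z x) * \<psi> x)" for s
      unfolding M_def by (subst integral_real_density) auto
    have i: "integrable lborel (\<lambda>x. max 0 (s * z x) * \<psi> x)" for s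
    proof (rule Bochner_Integration.integrable_bound[where f = "\<lambda>x. B * (s * z x)"])
      show "AE x in lborel. norm (max 0 (s * z x) * \<psi> x) \<le> norm (B * (s * z x))"
      proof (intro AE_I2)
        fix x
        have "\<bar>max 0 (s * z x)\<bar> * \<bar>\<psi> x\<bar> \<le> \<bar>s * z x\<bar> * \<bar>B\<bar>"
          using B[of x] by (intro mult_mono) auto
        then show "norm (max 0 (s * z x) * \<psi> x) \<le> norm (B * (s * z x))" by (simp add: abs_mult mult.commute)
      qed
    qed (use zi in auto)
    have out: "\<psi> x = 0" if "x \<notin> {a<..<b}" for x
    proof -
      obtain c d where "a < c" "d < b" "\<And>x. x \<notin> {c..d} \<Longrightarrow> \<psi> x = 0"
        using test_functionE[OF \<psi> ab] by metis
      then show ?thesis using that by auto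
    qed
    have "(LINT x|M 1. \<psi> x) - (LINT x|M (- 1). \<psi> x) = (LBINT x. max 0 (1 * z x) * \<psi> x - max 0 ((- 1) * z x) * \<psi> x)"
      unfolding d using i by (intro Bochner_Integration.integral_diff[symmetric])
    also have "\<dots> = (LBINT x. w x * \<psi> x - k * \<psi> x)"
    proof (rule Bochner_Integration.integral_cong[OF refl])
      fix x
      have "max 0 (1 * z x) * \<psi> x - max 0 ((- 1) * z x) * \<psi> x = z x * \<psi> x"
        by (cases "z x \<ge> 0") (auto simp: max_def)
      also have "\<dots> = w x * \<psi> x - k * \<psi> x"
        using out[of x] by (cases "x \<in> {a<..<b}") (auto simp: z_def algebra_simps)
      finally show "max 0 (1 * z x) * \<psi> x - max 0 ((- 1) * z x) * \<psi> x = w x * \<psi> x - k * \<psi> x" .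
    qed
    also have "\<dots> = 0" using key[OF \<psi>] by simp
    finally show ?thesis .
  qed
  \<comment> \<open>The second signed measure in the comparison is \<open>M 1\<close> minus itself,
    that is, zero.\<close>
  have "measure (M 1) A = measure (M (- 1)) A" if "A \<in> sets borel" for A
    using signed_measure_unique[OF ab M_fin M_fin M_fin M_fin, of 1 "- 1" 1 1 A] M_int that by simp
  then have "emeasure (M 1) A = emeasure (M (- 1)) A" if "A \<in> sets borel" for A
    using that by (simp add: finite_measure.emeasure_eq_measure[OF fin_borel_onD(1)[OF M_fin]])
  then have "M 1 = M (- 1)"
    by (intro measure_eqI) (simp_all add: fin_borel_onD(2)[OF M_fin])
  then have "AE x in lborel. ennreal (max 0 (1 * z x)) = ennreal (max 0 ((- 1) * z x))"
    unfolding M_def by (subst (asm) sigma_finite_measure.density_unique_iff[OF sigma_finite_lborel]) auto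
  then have "AE x in lborel. x \<in> {a<..<b} \<longrightarrow> w x = k"
    by eventually_elim (auto simp: z_def indicator_def max_def split: if_splits)
  then show thesis by (rule that)
qed

text \<open>In \<open>has_distr_deriv\<close> the measures live on (a, b), and
  \<open>measure\<close> is 0 off their \<sigma>-algebra. The second branch reproduces these values,
  since derivatives are compared as functions on all sets.\<close>

definition signed_diff :: "real \<Rightarrow> real \<Rightarrow> real measure \<Rightarrow> real measure \<Rightarrow> real set \<Rightarrow> real" where
  "signed_diff a b P N = (\<lambda>A. if A \<in> sets borel \<and> A \<subseteq> {a<..<b} then measure P A - measure N A else 0)"

lemma sets_restrict_Ioo: "A \<in> sets (restrict_space borel {a<..<b}) \<longleftrightarrow> A \<in> sets borel \<and> A \<subseteq> {a<..<b::real}"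
  by (subst sets_restrict_space_iff) auto

text \<open>Measures on (a, b) and measures on the line without mass outside it correspond by
  push-forward under the identity (\<open>ext\<close>) and by restriction (\<open>res\<close>). On
  the line all half-lines are measurable, as distribution functions require.\<close>

lemma has_distr_deriv_iff:
  "has_distr_deriv a b u D \<longleftrightarrow> (\<exists>P N. fin_borel_on a b P \<and> fin_borel_on a b N \<and> D = signed_diff a b P N \<and>
     (\<forall>\<phi>. test_function a b \<phi> \<longrightarrow>
        (LINT x:{a<..<b}|lebesgue. u x * deriv \<phi> x) = - ((LINT x|P. \<phi> x) - (LINT x|N. \<phi> x))))"
  if ab: "a < b"
proof
  let ?R = "restrict_space borel {a<..<b}"
  have sm: "\<phi> \<in> borel_measurable borel" if "test_function a b \<phi>" for \<phi>
    using test_functionE[OF that ab] smooth_borel_measurable by metis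
  {
    fix P assume P: "finite_measure P" "sets P = sets ?R"
    interpret finite_measure P by fact
    define P' where "P' = distr P borel (\<lambda>x. x)"
    have sp: "space P = {a<..<b}" using sets_eq_imp_space_eq[OF P(2)] by simp
    have m: "(\<lambda>x. x) \<in> measurable P borel"
      unfolding measurable_cong_sets[OF P(2) refl] by (rule measurable_restrict_space1) simp
    have "fin_borel_on a b P'"
    proof (rule fin_borel_onI)
      show "finite_measure P'" unfolding P'_def by (rule finite_measure_distr[OF m])
      show "sets P' = sets borel" by (simp add: P'_def)
      show "AE x in P'. x \<in> {a<..<b}"
        unfolding P'_def by (subst AE_distr_iff[OF m]) (use sp in \<open>auto intro: AE_I2\<close>)
    qed
    moreover have "measure P A = (if A \<in> sets borel \<and> A \<subseteq> {a<..<b} then measure P' A else 0)" for A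
    proof (cases "A \<in> sets P")
      case True
      then have A: "A \<in> sets borel" "A \<subseteq> {a<..<b}" using P(2) sets_restrict_Ioo by auto
      then show ?thesis unfolding P'_def using sp by (subst measure_distr[OF m]) (auto simp: Int_absorb2)
    next
      case False
      then show ?thesis using P(2) sets_restrict_Ioo[of A a b] by (auto simp: measure_notin_sets)
    qed
    moreover have "(LINT x|P. \<phi> x) = (LINT x|P'. \<phi> x)" if "test_function a b \<phi>" for \<phi>
      unfolding P'_def by (rule integral_distr[OF m sm[OF that], symmetric])
    ultimately have "\<exists>P'. fin_borel_on a b P' \<and>
        (\<forall>A. measure P A = (if A \<in> sets borel \<and> A \<subseteq> {a<..<b} then measure P' A else 0)) \<and>
        (\<forall>\<phi>. test_function a b \<phi> \<longrightarrow> (LINT x|P. \<phi> x) = (LINT x|P'. \<phi> x))" by blast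
  } note ext = this
  {
    assume "has_distr_deriv a b u D"
    then obtain P N where PN: "finite_measure P" "sets P = sets ?R" "finite_measure N" "sets N = sets ?R"
      "D = (\<lambda>A. measure P A - measure N A)"
      "\<forall>\<phi>. test_function a b \<phi> \<longrightarrow>
        (LINT x:{a<..<b}|lebesgue. u x * deriv \<phi> x) = - ((LINT x|P. \<phi> x) - (LINT x|N. \<phi> x))"
      unfolding has_distr_deriv_def by blast
    obtain P' where P': "fin_borel_on a b P'"
        "\<And>A. measure P A = (if A \<in> sets borel \<and> A \<subseteq> {a<..<b} then measure P' A else 0)"
        "\<And>\<phi>. test_function a b \<phi> \<Longrightarrow> (LINT x|P. \<phi> x) = (LINT x|P'. \<phi> x)" using ext[OF PN(1,2)] by blast
    obtain N' where N': "fin_borel_on a b N'"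
        "\<And>A. measure N A = (if A \<in> sets borel \<and> A \<subseteq> {a<..<b} then measure N' A else 0)"
        "\<And>\<phi>. test_function a b \<phi> \<Longrightarrow> (LINT x|N. \<phi> x) = (LINT x|N'. \<phi> x)" using ext[OF PN(3,4)] by blast
    have "D = signed_diff a b P' N'" unfolding PN(5) signed_diff_def P'(2) N'(2) by auto
    then show "\<exists>P N. fin_borel_on a b P \<and> fin_borel_on a b N \<and> D = signed_diff a b P N \<and>
     (\<forall>\<phi>. test_function a b \<phi> \<longrightarrow>
        (LINT x:{a<..<b}|lebesgue. u x * deriv \<phi> x) = - ((LINT x|P. \<phi> x) - (LINT x|N. \<phi> x)))"
      using P'(1,3) N'(1,3) PN(6) by (intro exI[of _ P'] exI[of _ N']) auto
  }
  {
    fix P assume P: "fin_borel_on a b P"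
    note P' = fin_borel_onD[OF P]
    define P' where "P' = restrict_space P {a<..<b}"
    have "finite_measure P'" unfolding P'_def using P' by (intro finite_measure_restrict_space) auto
    moreover have s: "sets P' = sets ?R" unfolding P'_def using P'(2) by (rule sets_restrict_space_cong)
    moreover have "measure P' A = (if A \<in> sets borel \<and> A \<subseteq> {a<..<b} then measure P A else 0)" for A
    proof (cases "A \<in> sets P'")
      case True
      then have A: "A \<in> sets borel" "A \<subseteq> {a<..<b}" using s sets_restrict_Ioo by auto
      then show ?thesis unfolding P'_def using P' by (subst measure_restrict_space) auto
    next
      case False
      then show ?thesis using s sets_restrict_Ioo[of A a b] by (auto simp: measure_notin_sets)
    qed
    moreover have "(LINT x|P'. \<phi> x) = (LINT x|P. \<phi> x)" if t: "test_function a b \<phi>" for \<phi>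
    proof -
      have "\<phi> \<in> borel_measurable P" using sm[OF t] measurable_cong_sets[OF P'(2) refl] by blast
      moreover have "(LINT x|P'. \<phi> x) = (LINT x:{a<..<b}|P. \<phi> x)"
        unfolding P'_def set_lebesgue_integral_def by (rule integral_restrict_space) (simp add: P'(2))
      moreover have "(LINT x:{a<..<b}|P. \<phi> x) = (LINT x|P. \<phi> x)"
        unfolding set_lebesgue_integral_def
      proof (rule integral_cong_AE)
        show "\<phi> \<in> borel_measurable P" by fact
        then show "(\<lambda>x. indicat_real {a<..<b} x *\<^sub>R \<phi> x) \<in> borel_measurable P"
          by (intro borel_measurable_scaleR borel_measurable_indicator) (simp_all add: P'(2))
        show "AE x in P. indicat_real {a<..<b} x *\<^sub>R \<phi> x = \<phi> x"
          using P'(5) by eventually_elim simp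
      qed
      ultimately show ?thesis by simp
    qed
    ultimately have "\<exists>P'. finite_measure P' \<and> sets P' = sets ?R \<and>
        (\<forall>A. measure P' A = (if A \<in> sets borel \<and> A \<subseteq> {a<..<b} then measure P A else 0)) \<and>
        (\<forall>\<phi>. test_function a b \<phi> \<longrightarrow> (LINT x|P'. \<phi> x) = (LINT x|P. \<phi> x))" by blast
  } note res = this
  {
    assume "\<exists>P N. fin_borel_on a b P \<and> fin_borel_on a b N \<and> D = signed_diff a b P N \<and>
     (\<forall>\<phi>. test_function a b \<phi> \<longrightarrow>
        (LINT x:{a<..<b}|lebesgue. u x * deriv \<phi> x) = - ((LINT x|P. \<phi> x) - (LINT x|N. \<phi> x)))"
    then obtain P N where PN: "fin_borel_on a b P" "fin_borel_on a b N" "D = signed_diff a b P N"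
      "\<And>\<phi>. test_function a b \<phi> \<Longrightarrow>
        (LINT x:{a<..<b}|lebesgue. u x * deriv \<phi> x) = - ((LINT x|P. \<phi> x) - (LINT x|N. \<phi> x))" by blast
    obtain P' where P': "finite_measure P'" "sets P' = sets ?R"
        "\<And>A. measure P' A = (if A \<in> sets borel \<and> A \<subseteq> {a<..<b} then measure P A else 0)"
        "\<And>\<phi>. test_function a b \<phi> \<Longrightarrow> (LINT x|P'. \<phi> x) = (LINT x|P. \<phi> x)" using res[OF PN(1)] by blast
    obtain N' where N': "finite_measure N'" "sets N' = sets ?R"
        "\<And>A. measure N' A = (if A \<in> sets borel \<and> A \<subseteq> {a<..<b} then measure N A else 0)"
        "\<And>\<phi>. test_function a b \<phi> \<Longrightarrow> (LINT x|N'. \<phi> x) = (LINT x|N. \<phi> x)" using res[OF PN(2)] by blast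
    have "D = (\<lambda>A. measure P' A - measure N' A)" unfolding PN(3) signed_diff_def P'(3) N'(3) by auto
    then show "has_distr_deriv a b u D"
      unfolding has_distr_deriv_def using P' N' PN(4) by (intro exI[of _ P'] exI[of _ N']) auto
  }
qed

lemma has_distr_deriv_unique:
  assumes ab: "a < b" and D: "has_distr_deriv a b u D1" "has_distr_deriv a b u D2"
  shows "D1 = D2"
proof -
  obtain P1 N1 where 1: "fin_borel_on a b P1" "fin_borel_on a b N1" "D1 = signed_diff a b P1 N1"
    "\<forall>\<phi>. test_function a b \<phi> \<longrightarrow>
        (LINT x:{a<..<b}|lebesgue. u x * deriv \<phi> x) = - ((LINT x|P1. \<phi> x) - (LINT x|N1. \<phi> x))"
    using D(1) has_distr_deriv_iff[OF ab] by blast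
  obtain P2 N2 where 2: "fin_borel_on a b P2" "fin_borel_on a b N2" "D2 = signed_diff a b P2 N2"
    "\<forall>\<phi>. test_function a b \<phi> \<longrightarrow>
        (LINT x:{a<..<b}|lebesgue. u x * deriv \<phi> x) = - ((LINT x|P2. \<phi> x) - (LINT x|N2. \<phi> x))"
    using D(2) has_distr_deriv_iff[OF ab] by blast
  have "measure P1 A - measure N1 A = measure P2 A - measure N2 A" if "A \<in> sets borel" for A
  proof (rule signed_measure_unique[OF ab 1(1,2) 2(1,2) _ that])
    fix \<phi> assume "test_function a b \<phi>"
    then show "(LINT x|P1. \<phi> x) - (LINT x|N1. \<phi> x) = (LINT x|P2. \<phi> x) - (LINT x|N2. \<phi> x)"
      using 1(4) 2(4) by (metis neg_equal_iff_equal)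
  qed
  then show ?thesis unfolding 1(3) 2(3) signed_diff_def by auto
qed

lemma distr_deriv_eq: "a < b \<Longrightarrow> has_distr_deriv a b u D \<Longrightarrow> distr_deriv a b u = D"
  unfolding distr_deriv_def using has_distr_deriv_unique by blast

text \<open>The half-line excludes t, so this is the left-continuous distribution function; its
  right limit at x exceeds its value by the signed mass of {x}.\<close>

definition signed_cdf :: "real measure \<Rightarrow> real measure \<Rightarrow> real \<Rightarrow> real" where
  "signed_cdf P N t = measure P {..<t} - measure N {..<t}"

lemma signed_cdf_measurable:
  "fin_borel_on a b P \<Longrightarrow> fin_borel_on a b N \<Longrightarrow> signed_cdf P N \<in> borel_measurable borel"
  unfolding signed_cdf_def[abs_def] using fin_borel_onD(1,2)
  by (intro borel_measurable_diff cdf_measurable) auto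

lemma signed_cdf_bound:
  assumes "fin_borel_on a b P" "fin_borel_on a b N"
  shows "\<bar>signed_cdf P N t\<bar> \<le> measure P UNIV + measure N UNIV"
proof -
  have "measure M {..<t} \<le> measure M UNIV" if "fin_borel_on a b M" for M
    using finite_measure.bounded_measure[OF fin_borel_onD(1)[OF that]] fin_borel_onD(3)[OF that] by simp
  from this[OF assms(1)] this[OF assms(2)] show ?thesis
    unfolding signed_cdf_def using measure_nonneg[of P "{..<t}"] measure_nonneg[of N "{..<t}"] by linarith
qed

lemma signed_cdf_orth:
  assumes ab: "a < b" and fin: "fin_borel_on a b P" "fin_borel_on a b N" and t: "test_function a b \<phi>"
  shows "integrable lborel (\<lambda>x. signed_cdf P N x * deriv \<phi> x)"
    "(LBINT x. signed_cdf P N x * deriv \<phi> x) = - ((LINT x|P. \<phi> x) - (LINT x|N. \<phi> x))"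
proof -
  have i: "integrable lborel (\<lambda>x. measure M {..<x} * deriv \<phi> x)" if M: "fin_borel_on a b M" for M
  proof (rule Bochner_Integration.integrable_bound[where f = "\<lambda>x. measure M UNIV * deriv \<phi> x"])
    have "measure M {..<x} \<le> measure M UNIV" for x
      using finite_measure.bounded_measure[OF fin_borel_onD(1)[OF M]] fin_borel_onD(3)[OF M] by simp
    then show "AE x in lborel. norm (measure M {..<x} * deriv \<phi> x) \<le> norm (measure M UNIV * deriv \<phi> x)"
      by (intro AE_I2) (auto simp: abs_mult intro!: mult_right_mono)
    have "deriv \<phi> \<in> borel_measurable borel"
      using test_function_deriv_integrable[OF t ab] by auto
    then show "(\<lambda>x. measure M {..<x} * deriv \<phi> x) \<in> borel_measurable lborel"
      using cdf_measurable[OF fin_borel_onD(1,2)[OF M]] by simp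
  qed (use test_function_deriv_integrable[OF t ab] in simp)
  show "integrable lborel (\<lambda>x. signed_cdf P N x * deriv \<phi> x)"
    unfolding signed_cdf_def left_diff_distrib using fin i by simp
  show "(LBINT x. signed_cdf P N x * deriv \<phi> x) = - ((LINT x|P. \<phi> x) - (LINT x|N. \<phi> x))"
    unfolding signed_cdf_def left_diff_distrib using i[OF fin(1)] i[OF fin(2)]
      integral_cdf_deriv[OF fin_borel_onD(1,2)[OF fin(1)] t ab] integral_cdf_deriv[OF fin_borel_onD(1,2)[OF fin(2)] t ab]
    by simp
qed

lemma set_integral_test_deriv:
  assumes ab: "a < b" and t: "test_function a b \<phi>" and "v \<in> borel_measurable borel"
    and u: "AE x in lebesgue. x \<in> {a<..<b} \<longrightarrow> u x = v x" "u \<in> borel_measurable (lebesgue_on {a<..<b})"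
  shows "(LINT x:{a<..<b}|lebesgue. u x * deriv \<phi> x) = (LBINT x. v x * deriv \<phi> x)"
proof -
  have out: "deriv \<phi> x = 0" if "x \<notin> {a<..<b}" for x
  proof -
    obtain c d where "a < c" "d < b" "\<And>x. x \<notin> {c..d} \<Longrightarrow> deriv \<phi> x = 0"
      using test_functionE[OF t ab] by metis
    then show ?thesis using that by auto
  qed
  have m: "deriv \<phi> \<in> borel_measurable borel" using test_function_deriv_integrable[OF t ab] by auto
  have um: "(\<lambda>x. indicator {a<..<b} x *\<^sub>R u x) \<in> borel_measurable lebesgue"
    using u(2) by (subst (asm) borel_measurable_restrict_space_iff) auto
  have "(LINT x:{a<..<b}|lebesgue. u x * deriv \<phi> x) = (LINT x|lebesgue. v x * deriv \<phi> x)"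
    unfolding set_lebesgue_integral_def
  proof (rule integral_cong_AE)
    show "AE x in lebesgue. indicat_real {a<..<b} x *\<^sub>R (u x * deriv \<phi> x) = v x * deriv \<phi> x"
      using u(1) by eventually_elim (use out in \<open>auto simp: indicator_def\<close>)
    have "(\<lambda>x. (indicator {a<..<b} x *\<^sub>R u x) * deriv \<phi> x) \<in> borel_measurable lebesgue"
      using um m by (intro borel_measurable_times) (auto intro: measurable_completion)
    then show "(\<lambda>x. indicat_real {a<..<b} x *\<^sub>R (u x * deriv \<phi> x)) \<in> borel_measurable lebesgue"
      by (simp add: mult.assoc)
    show "(\<lambda>x. v x * deriv \<phi> x) \<in> borel_measurable lebesgue"
      using assms(3) m by (auto intro: measurable_completion)
  qed
  also have "\<dots> = (LBINT x. v x * deriv \<phi> x)"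
    using assms(3) m by (intro integral_completion) auto
  finally show ?thesis .
qed

text \<open>By integration by parts, u minus the distribution function of its derivative is
  orthogonal to all derivatives of test functions, hence constant almost everywhere on (a,
  b).\<close>

lemma BV_representative:
  assumes ab: "a < b" and u: "u \<in> BV a b"
  obtains P N k where "fin_borel_on a b P" "fin_borel_on a b N" "distr_deriv a b u = signed_diff a b P N"
    "AE x in lebesgue. x \<in> {a<..<b} \<longrightarrow> u x = k + signed_cdf P N x"
proof -
  obtain D where ui: "u absolutely_integrable_on {a<..<b}" and D: "has_distr_deriv a b u D"
    using u by (auto simp: BV_def)
  obtain P N where PN: "fin_borel_on a b P" "fin_borel_on a b N" "D = signed_diff a b P N"
    "\<And>\<phi>. test_function a b \<phi> \<Longrightarrow>
        (LINT x:{a<..<b}|lebesgue. u x * deriv \<phi> x) = - ((LINT x|P. \<phi> x) - (LINT x|N. \<phi> x))"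
    using D has_distr_deriv_iff[OF ab] by blast
  define ui' where "ui' = (\<lambda>x. indicat_real {a<..<b} x *\<^sub>R u x)"
  have uil: "integrable lebesgue ui'" using ui by (simp add: set_integrable_def ui'_def)
  \<comment> \<open>u is only Lebesgue measurable, while the preceding results are about
    \<open>lborel\<close>; v is a Borel substitute.\<close>
  obtain v where v: "v \<in> borel_measurable lborel" "AE x in lborel. ui' x = v x"
    using completion_ex_borel_measurable_real[of ui' lborel] uil by auto
  have vi: "integrable lborel v"
  proof -
    have "integrable lebesgue v"
      using uil v by (subst integrable_cong_AE[of _ _ ui']) (auto intro: measurable_completion AE_completion elim!: eventually_mono)
    then show ?thesis using v(1) integrable_completion by blast
  qed
  have uv: "AE x in lebesgue. x \<in> {a<..<b} \<longrightarrow> u x = v x"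
    using AE_completion[OF v(2)] by eventually_elim (auto simp: ui'_def)
  have um: "u \<in> borel_measurable (lebesgue_on {a<..<b})"
    using uil by (subst borel_measurable_restrict_space_iff) (auto simp: ui'_def)
  \<comment> \<open>The distribution function need not vanish to the right of b. Cutting it off
    makes the difference integrable on the line and changes nothing where
    \<open>deriv \<phi>\<close> is nonzero.\<close>
  let ?w = "\<lambda>x. v x - indicator {a<..<b} x * signed_cdf P N x"
  have si: "integrable lborel (\<lambda>x. indicator {a<..<b} x * signed_cdf P N x)"
  proof (rule Bochner_Integration.integrable_bound[where f = "\<lambda>x. indicator {a<..<b} x * (measure P UNIV + measure N UNIV)"])
    show "integrable lborel (\<lambda>x. indicat_real {a<..<b} x * (measure P UNIV + measure N UNIV))"
      using ab by (intro integrable_mult_left integrable_real_indicator) (auto simp: emeasure_lborel_Ioo)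
    show "(\<lambda>x. indicator {a<..<b} x * signed_cdf P N x) \<in> borel_measurable lborel"
      using signed_cdf_measurable[OF PN(1,2)] by simp
    show "AE x in lborel. norm (indicator {a<..<b} x * signed_cdf P N x) \<le> norm (indicat_real {a<..<b} x * (measure P UNIV + measure N UNIV))"
      using signed_cdf_bound[OF PN(1,2)] by (intro AE_I2) (auto simp: indicator_def)
  qed
  have "(LBINT x. ?w x * deriv \<phi> x) = 0" if t: "test_function a b \<phi>" for \<phi>
  proof -
    have out: "indicator {a<..<b} x * signed_cdf P N x * deriv \<phi> x = signed_cdf P N x * deriv \<phi> x" for x
    proof -
      obtain c d where "a < c" "d < b" "\<And>x. x \<notin> {c..d} \<Longrightarrow> deriv \<phi> x = 0"
        using test_functionE[OF t ab] by metis
      then show ?thesis by (cases "x \<in> {a<..<b}") auto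
    qed
    obtain B where B: "\<And>x. \<bar>deriv \<phi> x\<bar> \<le> B" using test_function_bounded[OF t ab] by metis
    have m: "deriv \<phi> \<in> borel_measurable borel" using test_function_deriv_integrable[OF t ab] by auto
    have vint: "integrable lborel (\<lambda>x. v x * deriv \<phi> x)"
    proof (rule Bochner_Integration.integrable_bound[where f = "\<lambda>x. v x * B"])
      show "AE x in lborel. norm (v x * deriv \<phi> x) \<le> norm (v x * B)"
      proof (intro AE_I2)
        fix x
        have "\<bar>deriv \<phi> x\<bar> \<le> \<bar>B\<bar>" using B[of x] by linarith
        then show "norm (v x * deriv \<phi> x) \<le> norm (v x * B)" by (simp add: abs_mult mult_left_mono)
      qed
    qed (use vi v(1) m in auto)
    have "(LBINT x. ?w x * deriv \<phi> x) = (LBINT x. v x * deriv \<phi> x - signed_cdf P N x * deriv \<phi> x)"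
      by (intro Bochner_Integration.integral_cong refl) (simp add: left_diff_distrib out)
    also have "\<dots> = (LBINT x. v x * deriv \<phi> x) - (LBINT x. signed_cdf P N x * deriv \<phi> x)"
      by (rule Bochner_Integration.integral_diff[OF vint signed_cdf_orth(1)[OF ab PN(1,2) t]])
    also have "(LBINT x. v x * deriv \<phi> x) = (LINT x:{a<..<b}|lebesgue. u x * deriv \<phi> x)"
      using set_integral_test_deriv[OF ab t _ uv um] v(1) by simp
    finally show ?thesis using PN(4)[OF t] signed_cdf_orth(2)[OF ab PN(1,2) t] by simp
  qed
  then obtain k where k: "AE x in lborel. x \<in> {a<..<b} \<longrightarrow> ?w x = k"
    using du_Bois_Reymond[OF ab, of ?w] vi si by auto
  have "AE x in lebesgue. x \<in> {a<..<b} \<longrightarrow> u x = k + signed_cdf P N x"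
    using uv AE_completion[OF k] by eventually_elim auto
  then show thesis using that[OF PN(1,2)] distr_deriv_eq[OF ab D] PN(3) by blast
qed

text \<open>The converse direction, by which a step function obtains its derivative from a point
  measure.\<close>

lemma BV_cdf:
  assumes ab: "a < b" and fin: "fin_borel_on a b P" "fin_borel_on a b N"
    and u: "\<And>x. x \<in> {a<..<b} \<Longrightarrow> u x = k + signed_cdf P N x"
  shows "u \<in> BV a b" "distr_deriv a b u = signed_diff a b P N"
proof -
  let ?v = "\<lambda>x. k + signed_cdf P N x"
  have vm [measurable]: "?v \<in> borel_measurable borel"
    using signed_cdf_measurable[OF fin] by simp
  have "integrable lborel (\<lambda>x. indicator {a<..<b} x * ?v x)"
  proof (rule Bochner_Integration.integrable_bound[where f = "\<lambda>x. indicator {a<..<b} x * (\<bar>k\<bar> + (measure P UNIV + measure N UNIV))"])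
    show "integrable lborel (\<lambda>x. indicat_real {a<..<b} x * (\<bar>k\<bar> + (measure P UNIV + measure N UNIV)))"
      using ab by (intro integrable_mult_left integrable_real_indicator) (auto simp: emeasure_lborel_Ioo)
    have "\<bar>?v x\<bar> \<le> \<bar>\<bar>k\<bar> + (measure P UNIV + measure N UNIV)\<bar>" for x
      using signed_cdf_bound[OF fin, of x] by linarith
    then show "AE x in lborel. norm (indicator {a<..<b} x * ?v x) \<le> norm (indicat_real {a<..<b} x * (\<bar>k\<bar> + (measure P UNIV + measure N UNIV)))"
      by (intro AE_I2) (auto simp: indicator_def)
  qed measurable
  then have "integrable lebesgue (\<lambda>x. indicator {a<..<b} x * ?v x)"
    by (subst integrable_completion) auto
  moreover have uv: "(\<lambda>x. indicator {a<..<b} x * ?v x) = (\<lambda>x. indicator {a<..<b} x *\<^sub>R u x)"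
    using u by (auto simp: indicator_def fun_eq_iff)
  ultimately have ui: "u absolutely_integrable_on {a<..<b}"
    by (simp add: set_integrable_def)
  have um: "u \<in> borel_measurable (lebesgue_on {a<..<b})"
    using ui by (subst borel_measurable_restrict_space_iff) (auto simp: set_integrable_def)
  have "(LINT x:{a<..<b}|lebesgue. u x * deriv \<phi> x) = - ((LINT x|P. \<phi> x) - (LINT x|N. \<phi> x))"
    if t: "test_function a b \<phi>" for \<phi>
  proof -
    have "(LINT x:{a<..<b}|lebesgue. u x * deriv \<phi> x) = (LBINT x. ?v x * deriv \<phi> x)"
      using u um vm by (intro set_integral_test_deriv[OF ab t]) auto
    also have "\<dots> = (LBINT x. k * deriv \<phi> x + signed_cdf P N x * deriv \<phi> x)"
      by (simp add: distrib_right)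
    also have "\<dots> = k * (LBINT x. deriv \<phi> x) + (LBINT x. signed_cdf P N x * deriv \<phi> x)"
      using signed_cdf_orth(1)[OF ab fin t] test_function_deriv_integrable[OF t ab] by simp
    finally show ?thesis using integral_test_deriv[OF t ab] signed_cdf_orth(2)[OF ab fin t] by simp
  qed
  then have D: "has_distr_deriv a b u (signed_diff a b P N)"
    using has_distr_deriv_iff[OF ab] fin by blast
  then show "u \<in> BV a b" using ui by (auto simp: BV_def)
  show "distr_deriv a b u = signed_diff a b P N" using distr_deriv_eq[OF ab D] .
qed

section \<open>Jumps\<close>

lemma ae_lebesgue_Ioo_ex:
  assumes "AE t in lebesgue. R t" "c < (d::real)"
  shows "\<exists>t\<in>{c<..<d}. R t"
proof (rule ccontr)
  assume *: "\<not> (\<exists>t\<in>{c<..<d}. R t)"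
  have "AE t in lebesgue. t \<notin> {c<..<d}" using assms(1) by eventually_elim (use * in blast)
  then have "{c<..<d} \<in> null_sets lebesgue" using AE_iff_null_sets[of "{c<..<d}" lebesgue] by simp
  then show False using assms(2) by (simp add: null_sets_def)
qed

text \<open>A null set contains no interval, so the essential filters are proper; this makes
  essential one-sided limits unique and \<open>Lim\<close> meaningful.\<close>

lemma ess_at_right_neq_bot: "ess_at_right x \<noteq> bot"
proof
  assume "ess_at_right x = bot"
  then have "eventually (\<lambda>_. False) (ess_at_right x)" by simp
  then obtain Q R where Q: "eventually Q (at_right x)" and R: "AE t in lebesgue. R t" and QR: "\<And>t. Q t \<Longrightarrow> \<not> R t"
    unfolding ess_at_right_def eventually_inf by blast
  obtain d where "x < d" "\<And>t. x < t \<Longrightarrow> t < d \<Longrightarrow> Q t" using Q unfolding eventually_at_right_field by blast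
  then show False using ae_lebesgue_Ioo_ex[OF R \<open>x < d\<close>] QR by auto
qed

lemma ess_at_left_neq_bot: "ess_at_left x \<noteq> bot"
proof
  assume "ess_at_left x = bot"
  then have "eventually (\<lambda>_. False) (ess_at_left x)" by simp
  then obtain Q R where Q: "eventually Q (at_left x)" and R: "AE t in lebesgue. R t" and QR: "\<And>t. Q t \<Longrightarrow> \<not> R t"
    unfolding ess_at_left_def eventually_inf by blast
  obtain d where "d < x" "\<And>t. d < t \<Longrightarrow> t < x \<Longrightarrow> Q t" using Q unfolding eventually_at_left_field by blast
  then show False using ae_lebesgue_Ioo_ex[OF R \<open>d < x\<close>] QR by auto
qed

section \<open>One-sided limits of distribution functions\<close>

lemma cdf_tendsto_left:
  fixes P :: "real measure"
  assumes "finite_measure P" "sets P = sets borel"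
  shows "((\<lambda>t. measure P {..<t}) \<longlongrightarrow> measure P {..<x}) (at_left x)"
proof (rule order_tendstoI)
  interpret finite_measure P by fact
  have mono: "measure P {..<s} \<le> measure P {..<t}" if "s \<le> t" for s t
    using that assms(2) by (intro finite_measure_mono) auto
  show "eventually (\<lambda>t. measure P {..<t} < e) (at_left x)" if "measure P {..<x} < e" for e
  proof -
    have "measure P {..<t} < e" if "t < x" for t
      using mono[of t x] that \<open>measure P {..<x} < e\<close> by simp
    then show ?thesis by (simp add: eventually_at_filter)
  qed
  show "eventually (\<lambda>t. e < measure P {..<t}) (at_left x)" if e: "e < measure P {..<x}" for e
  proof -
    have "(\<Union>n. {..<x - 1 / real (Suc n)}) = {..<x}"
    proof (intro equalityI subsetI)
      fix t assume "t \<in> {..<x}"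
      then obtain n where "1 / real (Suc n) < x - t" using nat_approx_posE[of "x - t"] by auto
      then show "t \<in> (\<Union>n. {..<x - 1 / real (Suc n)})" by (auto intro!: exI[of _ n])
    next
      fix t assume "t \<in> (\<Union>n. {..<x - 1 / real (Suc n)})"
      then obtain n where "t < x - 1 / real (Suc n)" by auto
      moreover have "1 / real (Suc n) > 0" by simp
      ultimately have "t < x" by linarith
      then show "t \<in> {..<x}" by simp
    qed
    moreover have "incseq (\<lambda>n. {..<x - 1 / real (Suc n)})"
      by (intro monoI lessThan_subset_iff[THEN iffD2] diff_left_mono divide_left_mono) auto
    ultimately have "(\<lambda>n. measure P {..<x - 1 / real (Suc n)}) \<longlonglongrightarrow> measure P {..<x}"
      using finite_Lim_measure_incseq[of "\<lambda>n. {..<x - 1 / real (Suc n)}"] assms(2) by fastforce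
    then have "eventually (\<lambda>n. e < measure P {..<x - 1 / real (Suc n)}) sequentially"
      using e by (rule order_tendstoD(1))
    then obtain n where "e < measure P {..<x - 1 / real (Suc n)}" by (auto simp: eventually_sequentially)
    then have "\<And>t. x - 1 / real (Suc n) < t \<Longrightarrow> e < measure P {..<t}"
      using mono by (meson less_imp_le order_less_le_trans)
    then show ?thesis unfolding eventually_at_left_field
      by (intro exI[of _ "x - 1 / real (Suc n)"]) auto
  qed
qed

lemma cdf_tendsto_right:
  fixes P :: "real measure"
  assumes "finite_measure P" "sets P = sets borel"
  shows "((\<lambda>t. measure P {..<t}) \<longlongrightarrow> measure P {..x}) (at_right x)"
proof (rule order_tendstoI)
  interpret finite_measure P by fact
  show "eventually (\<lambda>t. e < measure P {..<t}) (at_right x)" if e: "e < measure P {..x}" for e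
  proof -
    have "e < measure P {..<t}" if "x < t" for t
      using finite_measure_mono[of "{..x}" "{..<t}"] that e assms(2) by fastforce
    then show ?thesis by (simp add: eventually_at_filter)
  qed
  show "eventually (\<lambda>t. measure P {..<t} < e) (at_right x)" if e: "measure P {..x} < e" for e
  proof -
    have "(\<Inter>n. {..<x + 1 / real (Suc n)}) = {..x}"
    proof (intro equalityI subsetI)
      fix t assume t: "t \<in> (\<Inter>n. {..<x + 1 / real (Suc n)})"
      show "t \<in> {..x}"
      proof (rule ccontr)
        assume "t \<notin> {..x}"
        then obtain n where "1 / real (Suc n) < t - x" using nat_approx_posE[of "t - x"] by auto
        moreover have "t < x + 1 / real (Suc n)" using t by blast
        ultimately show False by argo
      qed
    next
      fix t assume "t \<in> {..x}"
      moreover have "1 / real (Suc n) > 0" for n by simp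
      ultimately show "t \<in> (\<Inter>n. {..<x + 1 / real (Suc n)})" by (smt (verit) INT_I atMost_iff lessThan_iff)
    qed
    moreover have "decseq (\<lambda>n. {..<x + 1 / real (Suc n)})"
      by (intro antimonoI lessThan_subset_iff[THEN iffD2] add_left_mono divide_left_mono) auto
    ultimately have "(\<lambda>n. measure P {..<x + 1 / real (Suc n)}) \<longlonglongrightarrow> measure P {..x}"
      using finite_Lim_measure_decseq[of "\<lambda>n. {..<x + 1 / real (Suc n)}"] assms(2) by fastforce
    then have "eventually (\<lambda>n. measure P {..<x + 1 / real (Suc n)} < e) sequentially"
      using e by (rule order_tendstoD(2))
    then obtain n where n: "measure P {..<x + 1 / real (Suc n)} < e" by (auto simp: eventually_sequentially)
    have "measure P {..<t} < e" if "t < x + 1 / real (Suc n)" for t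
      using finite_measure_mono[of "{..<t}" "{..<x + 1 / real (Suc n)}"] that n assms(2) by fastforce
    then show ?thesis unfolding eventually_at_right_field
      by (intro exI[of _ "x + 1 / real (Suc n)"]) auto
  qed
qed

lemma signed_cdf_tendsto_left:
  assumes "fin_borel_on a b P" "fin_borel_on a b N"
  shows "(signed_cdf P N \<longlongrightarrow> signed_cdf P N x) (at_left x)"
  unfolding signed_cdf_def[abs_def]
  using fin_borel_onD(1,2)[OF assms(1)] fin_borel_onD(1,2)[OF assms(2)]
  by (intro tendsto_diff cdf_tendsto_left)

context
  fixes a b k :: real and P N :: "real measure" and u :: "real \<Rightarrow> real"
  assumes fin: "fin_borel_on a b P" "fin_borel_on a b N"
    and rep: "AE x in lebesgue. x \<in> {a<..<b} \<longrightarrow> u x = k + signed_cdf P N x"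
begin

lemma ess_left_limit:
  assumes "x \<in> {a<..<b}"
  shows "(u \<longlongrightarrow> k + signed_cdf P N x) (ess_at_left x)"
proof (rule Lim_transform_eventually)
  show "((\<lambda>t. k + signed_cdf P N t) \<longlongrightarrow> k + signed_cdf P N x) (ess_at_left x)"
    unfolding ess_at_left_def
    by (rule tendsto_mono[OF inf_le1]) (intro tendsto_add tendsto_const signed_cdf_tendsto_left[OF fin])
  have "eventually (\<lambda>t. t \<in> {a<..<b}) (at_left x)"
    using assms eventually_at_left_field by fastforce
  then have "eventually (\<lambda>t. t \<in> {a<..<b}) (ess_at_left x)"
    unfolding ess_at_left_def by (rule filter_leD[OF inf_le1])
  moreover have "eventually (\<lambda>t. t \<in> {a<..<b} \<longrightarrow> u t = k + signed_cdf P N t) (ess_at_left x)"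
    unfolding ess_at_left_def by (rule filter_leD[OF inf_le2 rep])
  ultimately show "eventually (\<lambda>t. k + signed_cdf P N t = u t) (ess_at_left x)"
    by eventually_elim simp
qed

lemma ess_right_limit:
  assumes "x \<in> {a<..<b}"
  shows "(u \<longlongrightarrow> k + signed_cdf P N x + (measure P {x} - measure N {x})) (ess_at_right x)"
proof (rule Lim_transform_eventually)
  have m: "measure M {..x} = measure M {..<x} + measure M {x}" if "fin_borel_on a b M" for M
  proof -
    interpret finite_measure M using fin_borel_onD(1)[OF that] .
    have *: "{..x} = {..<x} \<union> {x}" by auto
    show ?thesis unfolding * by (intro finite_measure_Union) (auto simp: fin_borel_onD(2)[OF that])
  qed
  have "((\<lambda>t. k + signed_cdf P N t) \<longlongrightarrow> k + (measure P {..x} - measure N {..x})) (at_right x)"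
    unfolding signed_cdf_def using fin_borel_onD(1,2)[OF fin(1)] fin_borel_onD(1,2)[OF fin(2)]
    by (intro tendsto_intros cdf_tendsto_right)
  then show "((\<lambda>t. k + signed_cdf P N t) \<longlongrightarrow> k + signed_cdf P N x + (measure P {x} - measure N {x})) (ess_at_right x)"
    unfolding ess_at_right_def m[OF fin(1)] m[OF fin(2)] signed_cdf_def
    by (intro tendsto_mono[OF inf_le1]) (simp add: algebra_simps)
  have "eventually (\<lambda>t. t \<in> {a<..<b}) (at_right x)"
    using assms eventually_at_right_field by fastforce
  then have "eventually (\<lambda>t. t \<in> {a<..<b}) (ess_at_right x)"
    unfolding ess_at_right_def by (rule filter_leD[OF inf_le1])
  moreover have "eventually (\<lambda>t. t \<in> {a<..<b} \<longrightarrow> u t = k + signed_cdf P N t) (ess_at_right x)"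
    unfolding ess_at_right_def by (rule filter_leD[OF inf_le2 rep])
  ultimately show "eventually (\<lambda>t. k + signed_cdf P N t = u t) (ess_at_right x)"
    by eventually_elim simp
qed

text \<open>Both one-sided limits exist at every point and differ by the signed mass of {x}. As P
  and N may share atoms, the criterion is that their masses at x differ, not that one of them is
  positive.\<close>

lemma jump_set_atoms: "jump_set a b u = {x \<in> {a<..<b}. measure P {x} \<noteq> measure N {x}}"
proof -
  have "(\<exists>l r. (u \<longlongrightarrow> l) (ess_at_left x) \<and> (u \<longlongrightarrow> r) (ess_at_right x) \<and> l \<noteq> r)
      \<longleftrightarrow> measure P {x} \<noteq> measure N {x}" if x: "x \<in> {a<..<b}" for x
  proof
    assume "\<exists>l r. (u \<longlongrightarrow> l) (ess_at_left x) \<and> (u \<longlongrightarrow> r) (ess_at_right x) \<and> l \<noteq> r"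
    then obtain l r where "(u \<longlongrightarrow> l) (ess_at_left x)" "(u \<longlongrightarrow> r) (ess_at_right x)" "l \<noteq> r" by blast
    moreover from this have "l = k + signed_cdf P N x" "r = k + signed_cdf P N x + (measure P {x} - measure N {x})"
      using tendsto_unique[OF ess_at_left_neq_bot _ ess_left_limit[OF x]]
        tendsto_unique[OF ess_at_right_neq_bot _ ess_right_limit[OF x]] by blast+
    ultimately show "measure P {x} \<noteq> measure N {x}" by simp
  next
    assume "measure P {x} \<noteq> measure N {x}"
    then show "\<exists>l r. (u \<longlongrightarrow> l) (ess_at_left x) \<and> (u \<longlongrightarrow> r) (ess_at_right x) \<and> l \<noteq> r"
      using ess_left_limit[OF x] ess_right_limit[OF x] by (metis add_cancel_right_right right_minus_eq)
  qed
  then show ?thesis unfolding jump_set_def by blast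
qed

lemma jump_height:
  assumes "x \<in> {a<..<b}"
  shows "right_value u x - left_value u x = measure P {x} - measure N {x}"
  using tendsto_Lim[OF ess_at_left_neq_bot ess_left_limit[OF assms]]
    tendsto_Lim[OF ess_at_right_neq_bot ess_right_limit[OF assms]]
  unfolding right_value_def left_value_def by simp

end

section \<open>The lower bound\<close>

lemma sat_abs_add: "sat \<bar>x + y\<bar> \<le> sat \<bar>x\<bar> + sat \<bar>y\<bar>"
  using sat_mono[of "\<bar>x + y\<bar>" "\<bar>x\<bar> + \<bar>y\<bar>"] sat_subadd[of "\<bar>x\<bar>" "\<bar>y\<bar>"] by linarith

lemma sat_abs_sum:
  fixes f :: "'a \<Rightarrow> real"
  assumes "finite F"
  shows "sat \<bar>\<Sum>x\<in>F. f x\<bar> \<le> (\<Sum>x\<in>F. sat \<bar>f x\<bar>)"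
  using assms
proof (induction F)
  case (insert x F)
  then show ?case using sat_abs_add[of "f x" "sum f F"] by simp
qed simp

lemma sum_le_variation:
  assumes "finite I" "disjoint_family_on C I" "(\<Union>i\<in>I. C i) = A" "\<And>i. i \<in> I \<Longrightarrow> C i \<in> sets borel" "D {} = 0"
  shows "ennreal (\<Sum>i\<in>I. \<bar>D (C i)\<bar>) \<le> variation D A"
proof -
  \<comment> \<open>Some \<open>C i\<close> may be empty, and \<open>partition_on\<close> admits no
    empty block. On the remaining indices disjointness makes C injective.\<close>
  define I' where "I' = {i \<in> I. C i \<noteq> {}}"
  have inj: "inj_on C I'"
    using assms(2) by (force simp: I'_def inj_on_def disjoint_family_on_def)
  have "(\<Sum>i\<in>I. \<bar>D (C i)\<bar>) = (\<Sum>i\<in>I'. \<bar>D (C i)\<bar>)"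
    using assms(1,5) by (intro sum.mono_neutral_right) (auto simp: I'_def)
  also have "\<dots> = (\<Sum>B\<in>C ` I'. \<bar>D B\<bar>)" by (simp add: sum.reindex[OF inj])
  finally have eq: "ennreal (\<Sum>i\<in>I. \<bar>D (C i)\<bar>) = (\<Sum>B\<in>C ` I'. ennreal \<bar>D B\<bar>)"
    by (simp add: sum_ennreal)
  have "partition_on A (C ` I')"
  proof (rule partition_onI)
    show "\<Union>(C ` I') = A" using assms(3) by (auto simp: I'_def)
    show "disjnt p q" if pq: "p \<in> C ` I'" "q \<in> C ` I'" "p \<noteq> q" for p q
    proof -
      from pq(1) obtain i where i: "p = C i" "i \<in> I'" by (rule imageE)
      from pq(2) obtain j where j: "q = C j" "j \<in> I'" by (rule imageE)
      have "i \<in> I" "j \<in> I" "i \<noteq> j" using i j pq(3) by (auto simp: I'_def)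
      then show ?thesis using assms(2) unfolding i j disjoint_family_on_def disjnt_def by simp
    qed
    show "{} \<notin> C ` I'" by (auto simp: I'_def)
  qed
  then show ?thesis
    unfolding variation_def eq using assms(1,4)
    by (intro SUP_upper) (auto simp: I'_def)
qed

lemma countable_borel: "countable A \<Longrightarrow> (A :: real set) \<in> sets borel"
  by (rule sets.countable) auto

text \<open>Continuity from above along an enumeration of J. It reduces a possibly infinite jump set
  to finitely many jumps, for which subadditivity of \<open>sat\<close> can be applied, and a
  remainder of small mass.\<close>

lemma finite_atoms_exhaust:
  fixes J :: "real set"
  assumes "finite_measure P" "sets P = sets borel" "finite_measure N" "sets N = sets borel" "countable J" "0 < e"
  obtains F where "finite F" "F \<subseteq> J" "measure P (J - F) + measure N (J - F) < e"
proof (cases "J = {}")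
  case True
  then show thesis using that[of "{}"] assms by simp
next
  case False
  define F where "F n = from_nat_into J ` {..<n}" for n :: nat
  have FJ: "F n \<subseteq> J" for n using from_nat_into[OF False] by (auto simp: F_def)
  have meas: "J - F n \<in> sets borel" for n
    using assms(5) by (intro countable_borel countable_Diff) 
  have "(\<Inter>n. J - F n) = {}"
    using from_nat_into_surj[OF assms(5)] by (fastforce simp: F_def)
  moreover have "decseq (\<lambda>n. J - F n)"
    by (intro antimonoI Diff_mono) (auto simp: F_def)
  ultimately have "(\<lambda>n. measure M (J - F n)) \<longlonglongrightarrow> measure M {}"
    if "finite_measure M" "sets M = sets borel" for M
    using finite_measure.finite_Lim_measure_decseq[OF that(1), of "\<lambda>n. J - F n"] that(2) meas
    by (metis image_subsetI)
  then have "(\<lambda>n. measure P (J - F n) + measure N (J - F n)) \<longlonglongrightarrow> measure P {} + measure N {}"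
    using assms by (intro tendsto_add) blast+
  then have "eventually (\<lambda>n. measure P (J - F n) + measure N (J - F n) < e) sequentially"
    using assms(6) by (intro order_tendstoD(2)) auto
  then obtain n where "measure P (J - F n) + measure N (J - F n) < e" by (auto simp: eventually_sequentially)
  then show thesis using that[of "F n"] FJ by (simp add: F_def)
qed

text \<open>The signed mass of a cell splits into the part off the jumps, finitely many jumps, and
  the other jumps. Subadditivity of \<open>sat\<close> lets them be charged separately: the first at
  its absolute value, to the variation; the jumps in F at their own \<open>sat\<close>; the rest at
  its mass, which totals at most e.\<close>

lemma TV_K_ge_increments:
  fixes p :: "nat \<Rightarrow> real"
  assumes ab: "a < b" and u: "u \<in> BV a b"
    and fin: "fin_borel_on a b P" "fin_borel_on a b N" and D: "distr_deriv a b u = signed_diff a b P N"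
    and rep: "AE x in lebesgue. x \<in> {a<..<b} \<longrightarrow> u x = k + signed_cdf P N x"
    and K: "\<And>\<rho>. 0 \<le> \<rho> \<Longrightarrow> K \<rho> = sat \<rho>"
    and p: "p 0 = a" "p n = b" "mono p"
  shows "ennreal (\<Sum>i<n. sat \<bar>signed_cdf P N (p (Suc i)) - signed_cdf P N (p i)\<bar>) \<le> TV_K K a b u"
proof -
  interpret P: finite_measure P using fin_borel_onD(1)[OF fin(1)] .
  interpret N: finite_measure N using fin_borel_onD(1)[OF fin(2)] .
  note sP [simp] = fin_borel_onD(2)[OF fin(1)] and sN [simp] = fin_borel_onD(2)[OF fin(2)]
  let ?D = "signed_diff a b P N"
  define J where "J = jump_set a b u"
  have J: "J = {x \<in> {a<..<b}. measure P {x} \<noteq> measure N {x}}"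
    unfolding J_def by (rule jump_set_atoms[OF fin rep])
  have "J \<subseteq> {x. measure P {x} \<noteq> 0} \<union> {x. measure N {x} \<noteq> 0}" unfolding J by auto
  then have cJ: "countable J"
    using P.countable_support N.countable_support by (meson countable_Un countable_subset)
  have Jsub: "J \<subseteq> {a<..<b}" by (auto simp: J)
  \<comment> \<open>Cells are closed on the left because \<open>signed_cdf\<close> counts the mass
    strictly left of a point: its increment from \<open>p i\<close> to \<open>p (Suc i)\<close> is
    the signed mass of the cell. The intersection removes the end point a.\<close>
  define C where "C i = {p i..<p (Suc i)} \<inter> {a<..<b}" for i
  have Cm: "C i \<in> sets borel" for i by (simp add: C_def)
  have cover: "(\<Union>i<n. C i) = {a<..<b}"
  proof -
    have "(\<Union>i<n. {p i..<p (Suc i)}) = {p 0..<p n}"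
    proof (induction n)
      case (Suc n)
      have "{p 0..<p n} \<union> {p n..<p (Suc n)} = {p 0..<p (Suc n)}"
        using p(3) by (intro ivl_disj_un) (auto simp: mono_def)
      then show ?case using Suc by (simp add: lessThan_Suc Un_commute)
    qed simp
    then have "(\<Union>i<n. C i) = {a..<b} \<inter> {a<..<b}" unfolding C_def p(1,2)[symmetric] by blast
    then show ?thesis by auto
  qed
  have disj: "disjoint_family_on C {..<n}"
  proof -
    have "C i \<inter> C j = {}" if "i < j" for i j
    proof -
      have "p (Suc i) \<le> p j" using p(3) that by (auto simp: mono_def)
      then show ?thesis by (auto simp: C_def)
    qed
    then show ?thesis unfolding disjoint_family_on_def by (metis Int_commute linorder_neqE_nat)
  qed
  have Dsub: "?D A = measure P A - measure N A" if "A \<in> sets borel" "A \<subseteq> {a<..<b}" for A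
    using that by (simp add: signed_diff_def)
  have incr: "signed_cdf P N (p (Suc i)) - signed_cdf P N (p i) = measure P (C i) - measure N (C i)" for i
  proof -
    have le: "p i \<le> p (Suc i)" using p(3) by (auto simp: mono_def)
    have "measure M {..<p (Suc i)} = measure M {..<p i} + measure M (C i)" if M: "fin_borel_on a b M" for M
    proof -
      interpret M: finite_measure M using fin_borel_onD(1)[OF M] .
      have *: "{..<p (Suc i)} = {..<p i} \<union> {p i..<p (Suc i)}" using le by auto
      have "measure M ({..<p i} \<union> {p i..<p (Suc i)}) = measure M {..<p i} + measure M {p i..<p (Suc i)}"
        by (intro M.finite_measure_Union) (auto simp: fin_borel_onD(2)[OF M])
      then show ?thesis using fin_borel_onD(4)[OF M, of "{p i..<p (Suc i)}"] * by (simp add: C_def)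
    qed
    from this[OF fin(1)] this[OF fin(2)] show ?thesis by (simp add: signed_cdf_def)
  qed
  show ?thesis
  proof (rule ennreal_le_epsilon)
    fix e :: real assume "0 < e"
    then obtain F where F: "finite F" "F \<subseteq> J" "measure P (J - F) + measure N (J - F) < e"
      using finite_atoms_exhaust[of P N J e] cJ P.finite_measure_axioms N.finite_measure_axioms sP sN by blast
    define \<mu> where "\<mu> A = measure P A + measure N A" for A
    define h where "h t = measure P {t} - measure N {t}" for t
    have Jm: "J \<in> sets borel" "J - F \<in> sets borel" "F \<in> sets borel"
      using cJ F by (auto intro!: countable_borel countable_Diff intro: countable_finite)
    have cell: "sat \<bar>signed_cdf P N (p (Suc i)) - signed_cdf P N (p i)\<bar>
        \<le> \<bar>?D (C i - J)\<bar> + \<mu> (C i \<inter> (J - F)) + (\<Sum>t\<in>F \<inter> C i. sat \<bar>h t\<bar>)" for i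
    proof -
      have split: "measure M (C i) = measure M (C i - J) + measure M (C i \<inter> (J - F)) + (\<Sum>t\<in>F \<inter> C i. measure M {t})"
        if M: "fin_borel_on a b M" for M
      proof -
        interpret M: finite_measure M using fin_borel_onD(1)[OF M] .
        note s = fin_borel_onD(2)[OF M]
        have "measure M (F \<inter> C i) = (\<Sum>t\<in>F \<inter> C i. measure M {t})"
          using F(1) by (intro M.finite_measure_eq_sum_singleton) (auto simp: s)
        moreover have "measure M ((C i - J) \<union> (C i \<inter> (J - F))) = measure M (C i - J) + measure M (C i \<inter> (J - F))"
          using Cm Jm by (intro M.finite_measure_Union) (auto simp: s)
        moreover have "measure M (((C i - J) \<union> (C i \<inter> (J - F))) \<union> (F \<inter> C i)) = measure M ((C i - J) \<union> (C i \<inter> (J - F))) + measure M (F \<inter> C i)"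
          using Cm Jm F(2) by (intro M.finite_measure_Union) (auto simp: s)
        moreover have "((C i - J) \<union> (C i \<inter> (J - F))) \<union> (F \<inter> C i) = C i" using F(2) by auto
        ultimately show ?thesis by simp
      qed
      define x where "x = ?D (C i - J)"
      define y where "y = measure P (C i \<inter> (J - F)) - measure N (C i \<inter> (J - F))"
      have x: "x = measure P (C i - J) - measure N (C i - J)"
        unfolding x_def using Cm Jm by (intro Dsub) (auto simp: C_def)
      have eq: "signed_cdf P N (p (Suc i)) - signed_cdf P N (p i) = x + y + (\<Sum>t\<in>F \<inter> C i. h t)"
        unfolding incr split[OF fin(1)] split[OF fin(2)] x y_def h_def by (simp add: sum_subtractf)
      have "sat \<bar>x + y + (\<Sum>t\<in>F \<inter> C i. h t)\<bar> \<le> sat \<bar>x\<bar> + sat \<bar>y\<bar> + (\<Sum>t\<in>F \<inter> C i. sat \<bar>h t\<bar>)"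
        using sat_abs_add[of "x + y" "\<Sum>t\<in>F \<inter> C i. h t"] sat_abs_add[of x y]
          sat_abs_sum[of "F \<inter> C i" h] F(1) by simp
      moreover have "sat \<bar>x\<bar> \<le> \<bar>x\<bar>" "sat \<bar>y\<bar> \<le> \<bar>y\<bar>" by (auto intro: sat_le)
      moreover have "\<bar>y\<bar> \<le> \<mu> (C i \<inter> (J - F))"
        unfolding y_def \<mu>_def using measure_nonneg[of P "C i \<inter> (J - F)"] measure_nonneg[of N "C i \<inter> (J - F)"] by linarith
      ultimately show ?thesis unfolding eq x_def[symmetric] by argo
    qed
    have 1: "(\<Sum>i<n. \<mu> (C i \<inter> (J - F))) \<le> e"
    proof -
      have "(\<Sum>i<n. measure M (C i \<inter> (J - F))) = measure M (J - F)" if M: "fin_borel_on a b M" for M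
      proof -
        interpret M: finite_measure M using fin_borel_onD(1)[OF M] .
        have "measure M (\<Union>i<n. C i \<inter> (J - F)) = (\<Sum>i<n. measure M (C i \<inter> (J - F)))"
          using disj Cm Jm by (intro M.finite_measure_finite_Union) 
            (auto simp: fin_borel_onD(2)[OF M] disjoint_family_on_def)
        moreover have "(\<Union>i<n. C i \<inter> (J - F)) = J - F" using cover Jsub by blast
        ultimately show ?thesis by simp
      qed
      from this[OF fin(1)] this[OF fin(2)] show ?thesis unfolding \<mu>_def sum.distrib using F(3) by simp
    qed
    have 2: "(\<Sum>i<n. \<Sum>t\<in>F \<inter> C i. sat \<bar>h t\<bar>) = (\<Sum>t\<in>F. sat \<bar>h t\<bar>)"
    proof -
      have "(\<Sum>i<n. \<Sum>t\<in>F \<inter> C i. sat \<bar>h t\<bar>) = (\<Sum>t\<in>(\<Union>i<n. F \<inter> C i). sat \<bar>h t\<bar>)"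
        using disj F(1) by (intro sum.UNION_disjoint[symmetric]) (auto simp: disjoint_family_on_def)
      moreover have "(\<Union>i<n. F \<inter> C i) = F" using cover Jsub F(2) by blast
      ultimately show ?thesis by simp
    qed
    have 3: "ennreal (\<Sum>i<n. \<bar>?D (C i - J)\<bar>) \<le> variation ?D ({a<..<b} - J)"
      using disj cover Cm Jm(1)
      by (intro sum_le_variation) (auto simp: disjoint_family_on_def signed_diff_def)
    have 4: "ennreal (\<Sum>t\<in>F. sat \<bar>h t\<bar>) \<le> (\<Sum>\<^sub>\<infinity>x\<in>J. ennreal (K \<bar>right_value u x - left_value u x\<bar>))"
    proof -
      have "ennreal (\<Sum>t\<in>F. sat \<bar>h t\<bar>) = (\<Sum>t\<in>F. ennreal (K \<bar>right_value u t - left_value u t\<bar>))"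
        using F(2) Jsub jump_height[OF fin rep] K
        by (subst sum_ennreal[symmetric]) (auto intro!: sum.cong simp: sat_nonneg h_def subset_iff)
      also have "\<dots> \<le> (\<Sum>\<^sub>\<infinity>x\<in>J. ennreal (K \<bar>right_value u x - left_value u x\<bar>))"
        using F by (subst nonneg_infsum_complete) (auto intro!: SUP_upper)
      finally show ?thesis .
    qed
    have "(\<Sum>i<n. sat \<bar>signed_cdf P N (p (Suc i)) - signed_cdf P N (p i)\<bar>)
        \<le> (\<Sum>i<n. \<bar>?D (C i - J)\<bar> + \<mu> (C i \<inter> (J - F)) + (\<Sum>t\<in>F \<inter> C i. sat \<bar>h t\<bar>))"
      by (intro sum_mono cell)
    also have "\<dots> \<le> (\<Sum>i<n. \<bar>?D (C i - J)\<bar>) + (\<Sum>t\<in>F. sat \<bar>h t\<bar>) + e"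
      using 1 2 by (simp add: sum.distrib)
    finally have "ennreal (\<Sum>i<n. sat \<bar>signed_cdf P N (p (Suc i)) - signed_cdf P N (p i)\<bar>)
        \<le> ennreal ((\<Sum>i<n. \<bar>?D (C i - J)\<bar>) + (\<Sum>t\<in>F. sat \<bar>h t\<bar>) + e)" by (rule ennreal_leI)
    also have "\<dots> = ennreal (\<Sum>i<n. \<bar>?D (C i - J)\<bar>) + ennreal (\<Sum>t\<in>F. sat \<bar>h t\<bar>) + ennreal e"
      using \<open>0 < e\<close> by (simp add: sum_nonneg sat_nonneg)
    also have "\<dots> \<le> TV_K K a b u + ennreal e"
      unfolding TV_K_def D J_def[symmetric] using 3 4 by (intro add_mono) auto
    finally show "ennreal (\<Sum>i<n. sat \<bar>signed_cdf P N (p (Suc i)) - signed_cdf P N (p i)\<bar>)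
        \<le> TV_K K a b u + ennreal e" .
  qed
qed

section \<open>Sampling on uniform grids\<close>

lemma gaps_map_upt: "gaps (map f [0..<Suc m]) = map (\<lambda>i. f (Suc i) - f i) [0..<m]"
proof (induction m arbitrary: f)
  case (Suc m)
  have 1: "[0..<Suc (Suc m)] = 0 # map Suc [0..<Suc m]" by (metis map_Suc_upt upt_conv_Cons zero_less_Suc)
  have 2: "[0..<Suc m] = 0 # map Suc [0..<m]" for m by (metis map_Suc_upt upt_conv_Cons zero_less_Suc)
  have "gaps (map f [0..<Suc (Suc m)]) = gaps (f 0 # map (f \<circ> Suc) [0..<Suc m])"
    unfolding 1 by simp
  also have "\<dots> = (f (Suc 0) - f 0) # gaps (map (f \<circ> Suc) [0..<Suc m])"
    unfolding 2 by simp
  also have "\<dots> = (f (Suc 0) - f 0) # map (\<lambda>i. f (Suc (Suc i)) - f (Suc i)) [0..<m]"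
    unfolding Suc.IH by simp
  finally show ?case unfolding 2[of m] by (simp add: comp_def)
qed simp

lemma sat_clip_diff:
  "sat \<bar>max a (min b x) - max a (min b y)\<bar> \<le> sat \<bar>x - y\<bar>"
  by (rule sat_mono) (auto simp: max_def min_def)

text \<open>Each grid turns u into a list of gaps to which the bound \<open>m\<close> applies. The
  jump cost of the samples is at most the one fixed number \<open>TV_K K a b u\<close>, so only the
  fidelity has to pass to the limit as the grid is refined.\<close>

lemma TV_Kg_ge:
  assumes ab: "a < b" and u: "u \<in> BV a b" and l: "0 < l"
    and K: "\<And>\<rho>. 0 \<le> \<rho> \<Longrightarrow> K \<rho> = sat \<rho>" and g: "\<And>x. x \<in> {a<..<b} \<Longrightarrow> g x = x"
    and m: "\<And>hs. \<forall>h\<in>set hs. 0 \<le> h \<Longrightarrow> sum_list hs \<le> b - a \<Longrightarrow> m \<le> energy l (b - a) hs"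
  shows "ennreal m \<le> TV_Kg K g l a b u"
proof -
  obtain P N k where fin: "fin_borel_on a b P" "fin_borel_on a b N" and D: "distr_deriv a b u = signed_diff a b P N"
    and rep: "AE x in lebesgue. x \<in> {a<..<b} \<longrightarrow> u x = k + signed_cdf P N x"
    using BV_representative[OF ab u] by metis
  define U where "U t = k + signed_cdf P N t" for t
  have Um [measurable]: "U \<in> borel_measurable borel"
    unfolding U_def[abs_def] using signed_cdf_measurable[OF fin] by simp
  \<comment> \<open>The last grid point strictly to the left of t. The ceiling minus 1, unlike the
    floor, is strict also at grid points, so that left-continuity of U gives convergence of U (s n
    t) at every t in (a, b).\<close>
  define s where "s n t = a + (b - a) * (real_of_int \<lceil>real (Suc n) * (t - a) / (b - a)\<rceil> - 1) / real (Suc n)" for n t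
  have sm [measurable]: "s n \<in> borel_measurable borel" for n
    unfolding s_def[abs_def] by measurable
  define p where "p n i = a + (b - a) * real i / real (Suc n)" for n i
  have s: "s n t < t" "t - (b - a) / real (Suc n) \<le> s n t" "\<exists>i\<le>n. s n t = p n i" if t: "t \<in> {a<..<b}" for n t
  proof -
    define q where "q = real (Suc n) * (t - a) / (b - a)"
    have q: "0 < q" "q < real (Suc n)" using t by (auto simp: q_def divide_less_eq)
    have tq: "t = a + (b - a) * q / real (Suc n)" using t by (simp add: q_def)
    have c: "real_of_int \<lceil>q\<rceil> - 1 < q" "q \<le> real_of_int \<lceil>q\<rceil>" by linarith+
    have sq: "s n t = a + (b - a) * (real_of_int \<lceil>q\<rceil> - 1) / real (Suc n)" by (simp add: s_def q_def)
    have "s n t < a + (b - a) * q / real (Suc n)"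
      unfolding sq using c ab by (intro add_strict_left_mono divide_strict_right_mono mult_strict_left_mono) auto
    then show "s n t < t" using tq by simp
    have "t - (b - a) / real (Suc n) = a + (b - a) * (q - 1) / real (Suc n)"
      unfolding tq by (simp add: diff_divide_distrib right_diff_distrib)
    also have "\<dots> \<le> s n t" unfolding sq using c ab by (intro add_left_mono divide_right_mono mult_left_mono) auto
    finally show "t - (b - a) / real (Suc n) \<le> s n t" .
    have "1 \<le> \<lceil>q\<rceil>" "\<lceil>q\<rceil> \<le> int (Suc n)" using q by (auto simp: ceiling_le_iff le_ceiling_iff)
    then have "nat (\<lceil>q\<rceil> - 1) \<le> n" "s n t = p n (nat (\<lceil>q\<rceil> - 1))" unfolding sq p_def by auto
    then show "\<exists>i\<le>n. s n t = p n i" by blast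
  qed
  define B where "B = \<bar>a\<bar> + \<bar>b\<bar> + \<bar>k\<bar> + (measure P UNIV + measure N UNIV)"
  have B: "(t - U r)\<^sup>2 \<le> B\<^sup>2" if "t \<in> {a<..<b}" for t r
  proof -
    have "\<bar>t - U r\<bar> \<le> B"
      using signed_cdf_bound[OF fin, of r] that unfolding U_def B_def by (auto simp: abs_le_iff)
    then show ?thesis using abs_le_square_iff[of "t - U r" B] by simp
  qed
  define I where "I n = (LBINT t. indicator {a<..<b} t * (t - U (s n t))\<^sup>2)" for n
  define I0 where "I0 = (LBINT t. indicator {a<..<b} t * (t - U t)\<^sup>2)"
  have indB: "integrable lborel (\<lambda>t. indicat_real {a<..<b} t * B\<^sup>2)"
    using ab by (intro integrable_mult_left integrable_real_indicator) (auto simp: emeasure_lborel_Ioo)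
  have intU: "integrable lborel (\<lambda>t. indicator {a<..<b} t * (t - U (r t))\<^sup>2)" if [measurable]: "r \<in> borel_measurable borel" for r
    by (rule Bochner_Integration.integrable_bound[OF indB]) (use B in \<open>auto simp: indicator_def\<close>)
  have lim: "I \<longlonglongrightarrow> I0"
    unfolding I_def I0_def
  proof (rule integral_dominated_convergence[OF _ _ indB])
    show "AE t in lborel. norm (indicator {a<..<b} t * (t - U (s n t))\<^sup>2) \<le> indicator {a<..<b} t * B\<^sup>2" for n
      using B by (auto simp: indicator_def)
    have "(\<lambda>n. (t - U (s n t))\<^sup>2) \<longlonglongrightarrow> (t - U t)\<^sup>2" if t: "t \<in> {a<..<b}" for t
    proof -
      have "(\<lambda>n. s n t) \<longlonglongrightarrow> t"
      proof (rule tendsto_sandwich[of "\<lambda>n. t - (b - a) / real (Suc n)" _ _ "\<lambda>_. t"])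
        have "(\<lambda>n. t - (b - a) / real (Suc n)) \<longlonglongrightarrow> t - 0"
          by (intro tendsto_diff tendsto_const) (rule LIMSEQ_Suc[OF lim_const_over_n])
        then show "(\<lambda>n. t - (b - a) / real (Suc n)) \<longlonglongrightarrow> t" by simp
      qed (use s[OF t] in \<open>auto intro!: always_eventually less_imp_le\<close>)
      then have "filterlim (\<lambda>n. s n t) (at_left t) sequentially"
      proof -
        assume "(\<lambda>n. s n t) \<longlonglongrightarrow> t"
        moreover have "s n t \<in> {..<t} \<and> s n t \<noteq> t" for n using s(1)[OF t, of n] by auto
        ultimately show ?thesis unfolding filterlim_at by (simp add: always_eventually)
      qed
      moreover have "(U \<longlongrightarrow> U t) (at_left t)"
        unfolding U_def[abs_def] by (intro tendsto_intros signed_cdf_tendsto_left[OF fin])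
      ultimately have "(\<lambda>n. U (s n t)) \<longlonglongrightarrow> U t" by (rule filterlim_compose[rotated])
      then show ?thesis by (intro tendsto_intros)
    qed
    then show "AE t in lborel. (\<lambda>n. indicator {a<..<b} t * (t - U (s n t))\<^sup>2) \<longlonglongrightarrow> indicator {a<..<b} t * (t - U t)\<^sup>2"
      by (auto simp: indicator_def)
  qed measurable
  have step: "ennreal m \<le> TV_K K a b u + ennreal (l / 2 * I n)" for n
  proof -
    \<comment> \<open>Clipping to [a, b] lengthens neither an increment nor the distance to a point
      t of (a, b), and it makes the gaps fit into the length b - a.\<close>
    define v where "v i = max a (min b (U (p n i)))" for i
    \<comment> \<open>There are n + 2 samples, at \<open>p n 0\<close> = a up to
      \<open>p n (Suc n)\<close> = b. The last point completes the cover of (a, b) by cells,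
      although \<open>s n t\<close> stays among the indices up to n.\<close>
    define rs where "rs = sort (map v [0..<Suc (Suc n)])"
    have set_rs: "set rs = v ` {..Suc n}"
      unfolding rs_def by (simp only: set_sort set_map set_upt atLeast0LessThan lessThan_Suc_atMost)
    have rs: "sorted rs" "rs \<noteq> []" "set rs \<subseteq> {a..b}"
    proof -
      show "sorted rs" by (simp add: rs_def)
      have "set rs \<noteq> {}" unfolding set_rs by simp
      then show "rs \<noteq> []" by force
      have "v i \<in> {a..b}" for i unfolding v_def using ab by auto
      then show "set rs \<subseteq> {a..b}" unfolding set_rs by blast
    qed
    define X where "X = (\<Sum>i<Suc n. sat \<bar>signed_cdf P N (p n (Suc i)) - signed_cdf P N (p n i)\<bar>)"
    have "(\<Sum>h\<leftarrow>gaps rs. sat h) \<le> (\<Sum>h\<leftarrow>gaps (map v [0..<Suc (Suc n)]). sat \<bar>h\<bar>)"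
      unfolding rs_def by (rule sum_gaps_sort_le)
    also have "\<dots> = (\<Sum>i<Suc n. sat \<bar>v (Suc i) - v i\<bar>)"
      unfolding gaps_map_upt by (simp add: comp_def interv_sum_list_conv_sum_set_nat atLeast0LessThan)
    also have "\<dots> \<le> X"
      unfolding X_def v_def using sat_clip_diff[of a b "U (p n (Suc i))" "U (p n i)" for i]
      by (intro sum_mono) (simp add: U_def)
    finally have X: "(\<Sum>h\<leftarrow>gaps rs. sat h) \<le> X" .
    have "ennreal X \<le> TV_K K a b u"
      unfolding X_def
    proof (rule TV_K_ge_increments[OF ab u fin D rep K])
      show "mono (p n)" using ab by (auto simp: p_def mono_def intro!: divide_right_mono mult_left_mono)
    qed (auto simp: p_def)
    moreover have "integral {a..b} (\<lambda>t. (infdist t (set rs))\<^sup>2) \<le> I n"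
    proof -
      have si: "set_integrable lborel {a<..<b} (\<lambda>t. (infdist t (set rs))\<^sup>2)"
        by (rule set_integrable_subset[OF borel_integrable_atLeastAtMost'[of a b]])
          (auto intro!: continuous_intros)
      have "integral {a..b} (\<lambda>t. (infdist t (set rs))\<^sup>2) = integral {a<..<b} (\<lambda>t. (infdist t (set rs))\<^sup>2)"
        using integral_open_interval_real[of a b] by metis
      also have "\<dots> = (LBINT t:{a<..<b}. (infdist t (set rs))\<^sup>2)"
        by (rule set_borel_integral_eq_integral(2)[OF si, symmetric])
      also have "\<dots> \<le> I n"
        unfolding I_def set_lebesgue_integral_def
      proof (rule integral_mono)
        show "integrable lborel (\<lambda>t. indicat_real {a<..<b} t *\<^sub>R (infdist t (set rs))\<^sup>2)"
          using si by (simp add: set_integrable_def)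
        show "integrable lborel (\<lambda>t. indicator {a<..<b} t * (t - U (s n t))\<^sup>2)" by (rule intU[OF sm])
        fix t :: real
        have "(infdist t (set rs))\<^sup>2 \<le> (t - U (s n t))\<^sup>2" if t: "t \<in> {a<..<b}"
        proof -
          obtain i where i: "i \<le> n" "s n t = p n i" using s(3)[OF t] by blast
          have "infdist t (set rs) \<le> dist t (v i)" using i set_rs by (intro infdist_le) auto
          also have "\<dots> \<le> \<bar>t - U (s n t)\<bar>"
            using t unfolding v_def i(2) by (auto simp: dist_real_def max_def min_def)
          finally show ?thesis using abs_le_square_iff[of "infdist t (set rs)" "t - U (s n t)"]
            by (simp add: infdist_nonneg)
        qed
        then show "indicat_real {a<..<b} t *\<^sub>R (infdist t (set rs))\<^sup>2 \<le> indicator {a<..<b} t * (t - U (s n t))\<^sup>2"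
          by (auto simp: indicator_def)
      qed
      finally show ?thesis .
    qed
    moreover have "m \<le> energy l (b - a) (gaps rs)"
    proof (rule m)
      show "\<forall>h\<in>set (gaps rs). 0 \<le> h" using gaps_nonneg[OF rs(1)] by blast
      have "last rs \<in> {a..b}" "hd rs \<in> {a..b}" using rs(3) hd_in_set[OF rs(2)] last_in_set[OF rs(2)] by blast+
      then show "sum_list (gaps rs) \<le> b - a" using sum_list_gaps[OF rs(2)] by simp
    qed
    moreover have "energy l (b - a) (gaps rs)
        \<le> (\<Sum>h\<leftarrow>gaps rs. sat h) + l / 2 * integral {a..b} (\<lambda>t. (infdist t (set rs))\<^sup>2)"
      using energy_le_values[OF rs] l by simp
    ultimately have "m \<le> X + l / 2 * I n"
    proof -
      assume *: "integral {a..b} (\<lambda>t. (infdist t (set rs))\<^sup>2) \<le> I n"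
        "m \<le> energy l (b - a) (gaps rs)"
        "energy l (b - a) (gaps rs) \<le> (\<Sum>h\<leftarrow>gaps rs. sat h) + l / 2 * integral {a..b} (\<lambda>t. (infdist t (set rs))\<^sup>2)"
      have "l / 2 * integral {a..b} (\<lambda>t. (infdist t (set rs))\<^sup>2) \<le> l / 2 * I n"
        using *(1) l by (intro mult_left_mono) auto
      then show ?thesis using *(2,3) X by argo
    qed
    then have "ennreal m \<le> ennreal (X + l / 2 * I n)" by (rule ennreal_leI)
    also have "\<dots> = ennreal X + ennreal (l / 2 * I n)"
    proof (rule ennreal_plus)
      show "0 \<le> X" unfolding X_def by (intro sum_nonneg sat_nonneg) simp
      show "0 \<le> l / 2 * I n" unfolding I_def using l by (intro mult_nonneg_nonneg integral_nonneg_AE) auto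
    qed
    also have "\<dots> \<le> TV_K K a b u + ennreal (l / 2 * I n)"
      using \<open>ennreal X \<le> TV_K K a b u\<close> by (intro add_right_mono)
    finally show ?thesis .
  qed
  have "(\<lambda>n. TV_K K a b u + ennreal (l / 2 * I n)) \<longlonglongrightarrow> TV_K K a b u + ennreal (l / 2 * I0)"
    by (intro tendsto_add tendsto_const tendsto_ennrealI tendsto_mult lim)
  then have "ennreal m \<le> TV_K K a b u + ennreal (l / 2 * I0)"
    by (rule LIMSEQ_le_const) (use step in blast)
  moreover have "ennreal (l / 2) * (\<integral>\<^sup>+x\<in>{a<..<b}. ennreal (\<bar>u x - g x\<bar>\<^sup>2) \<partial>lebesgue) = ennreal (l / 2 * I0)"
  proof -
    have "(\<integral>\<^sup>+x\<in>{a<..<b}. ennreal (\<bar>u x - g x\<bar>\<^sup>2) \<partial>lebesgue)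
        = (\<integral>\<^sup>+t. ennreal (indicator {a<..<b} t * (t - U t)\<^sup>2) \<partial>lebesgue)"
      by (intro nn_integral_cong_AE, use rep in eventually_elim)
        (auto simp: indicator_def g U_def power2_commute)
    also have "\<dots> = (\<integral>\<^sup>+t. ennreal (indicator {a<..<b} t * (t - U t)\<^sup>2) \<partial>lborel)"
      by (rule nn_integral_completion)
    also have "\<dots> = ennreal I0"
      unfolding I0_def using intU[of "\<lambda>t. t"] by (intro nn_integral_eq_integral) auto
    finally have eq: "(\<integral>\<^sup>+x\<in>{a<..<b}. ennreal (\<bar>u x - g x\<bar>\<^sup>2) \<partial>lebesgue) = ennreal I0" .
    show ?thesis unfolding eq by (rule ennreal_mult'[symmetric]) (use l in simp)
  qed
  ultimately show ?thesis unfolding TV_Kg_def by simp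
qed

section \<open>Step functions\<close>

text \<open>The two masses sit on \<open>bool\<close> and are pushed to the line, so that the
  measure of a set becomes a sum over the two indices.\<close>

lemma two_point_measure:
  assumes "t1 \<in> {a<..<b}" "t2 \<in> {a<..<b}" "0 \<le> h1" "0 \<le> h2"
  obtains P where "fin_borel_on a b P"
    "\<And>A. A \<in> sets borel \<Longrightarrow> measure P A = h1 * indicator A t1 + h2 * indicator A t2"
proof -
  define t where "t i = (if i then t1 else t2)" for i
  define Q where "Q = point_measure (UNIV :: bool set) (\<lambda>i. ennreal (if i then h1 else h2))"
  define P where "P = distr Q borel t"
  have tm: "t \<in> measurable Q borel" by (simp add: Q_def)
  have "emeasure P A = ennreal (h1 * indicator A t1 + h2 * indicator A t2)" if "A \<in> sets borel" for A
  proof -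
    have "emeasure P A = (\<Sum>i\<in>t -` A. ennreal (if i then h1 else h2))"
      unfolding P_def using that tm
      by (subst emeasure_distr) (auto simp: Q_def space_point_measure emeasure_point_measure_finite)
    also have "\<dots> = (\<Sum>i\<in>UNIV. ennreal (if i then h1 else h2) * indicator A (t i))"
      by (rule sum.mono_neutral_cong_left) (auto simp: indicator_def)
    also have "\<dots> = ennreal (h1 * indicator A t1 + h2 * indicator A t2)"
      using assms(3,4) by (auto simp: UNIV_bool t_def indicator_def)
    finally show ?thesis .
  qed note em = this
  then have me: "measure P A = h1 * indicator A t1 + h2 * indicator A t2" if "A \<in> sets borel" for A
    unfolding measure_def em[OF that] using assms(3,4) by (intro enn2real_ennreal) simp
  have "fin_borel_on a b P"
    unfolding fin_borel_on_def
  proof (intro conjI)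
    show "finite_measure P" using em[of UNIV] by (intro finite_measureI) (simp add: P_def)
    show "sets P = sets borel" by (simp add: P_def)
    show "measure P (- {a<..<b}) = 0" using me[of "- {a<..<b}"] assms by simp
  qed
  then show thesis using me that by blast
qed

lemma has_integral_square_dist:
  fixes p q v :: real
  assumes "p \<le> q" "\<And>x. x \<in> {p<..<q} \<Longrightarrow> f x = v"
  shows "((\<lambda>x. (f x - x)\<^sup>2) has_integral ((q - v) ^ 3 - (p - v) ^ 3) / 3) {p..q}"
proof -
  have "((\<lambda>x. (v - x)\<^sup>2) has_integral - ((v - q) ^ 3 / 3) - (- ((v - p) ^ 3 / 3))) {p..q}"
    by (rule fundamental_theorem_of_calculus[OF assms(1)])
      (auto intro!: derivative_eq_intros simp: has_real_derivative_iff_has_vector_derivative[symmetric] power2_eq_square)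
  moreover have "- ((v - q) ^ 3 / 3) - (- ((v - p) ^ 3 / 3)) = ((q - v) ^ 3 - (p - v) ^ 3) / 3"
    by (simp add: power3_eq_cube field_simps)
  ultimately have "((\<lambda>x. (v - x)\<^sup>2) has_integral ((q - v) ^ 3 - (p - v) ^ 3) / 3) (cbox p q)" by (simp only: cbox_interval)
  then have "((\<lambda>x. (f x - x)\<^sup>2) has_integral ((q - v) ^ 3 - (p - v) ^ 3) / 3) (cbox p q)"
    by (rule has_integral_spike_interior) (use assms(2) in auto)
  then show ?thesis by simp
qed

text \<open>The value \<open>h2 = 0\<close> yields the function with a single jump.\<close>
lemma step_function:
  fixes h1 h2 :: real
  assumes ab: "a < b" and h: "0 < h1" "0 \<le> h2" "h1 + h2 \<le> b - a" and h2: "0 < h2 \<or> h1 < b - a"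
    and l: "0 < l" and K: "\<And>\<rho>. 0 \<le> \<rho> \<Longrightarrow> K \<rho> = sat \<rho>" and g: "\<And>x. x \<in> {a<..<b} \<Longrightarrow> g x = x"
  obtains u where "u \<in> BV a b" "piecewise_constant a b u" "card (jump_set a b u) = (if h2 = 0 then 1 else 2)"
    "TV_Kg K g l a b u = ennreal (energy l (b - a) [h1, h2])"
proof -
  \<comment> \<open>Both end pieces get length \<alpha>, so the values are a + \<alpha>, a +
    \<alpha> + h1 and b - \<alpha>. As g is the identity, positions and values share one scale, and
    t1 and t2 are midpoints between consecutive values. If h2 = 0, the hypothesis h1 < b - a makes
    \<alpha> positive and keeps t2 = b - \<alpha> inside.\<close>
  define \<alpha> where "\<alpha> = (b - a - h1 - h2) / 2"
  define t1 where "t1 = a + \<alpha> + h1 / 2"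
  define t2 where "t2 = a + \<alpha> + h1 + h2 / 2"
  have t: "a < t1" "t1 < t2" "t2 < b" using h h2 by (auto simp: t1_def t2_def \<alpha>_def field_simps)
  obtain P where P: "fin_borel_on a b P"
    and Pm: "\<And>A. A \<in> sets borel \<Longrightarrow> measure P A = h1 * indicator A t1 + h2 * indicator A t2"
    using two_point_measure[of t1 a b t2 h1 h2] t h by auto
  define N where "N = null_measure (borel :: real measure)"
  have N: "fin_borel_on a b N"
    by (auto simp: fin_borel_on_def N_def intro!: finite_measureI)
  have Nm: "measure N A = 0" for A by (simp add: N_def)
  define u where "u x = a + \<alpha> + signed_cdf P N x" for x
  have u: "u x = a + \<alpha> + (if t1 < x then h1 else 0) + (if t2 < x then h2 else 0)" for x
    unfolding u_def signed_cdf_def Nm by (simp add: Pm indicator_def)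
  have um [measurable]: "u \<in> borel_measurable borel"
    unfolding u_def[abs_def] using signed_cdf_measurable[OF P N] by simp
  have BV: "u \<in> BV a b" "distr_deriv a b u = signed_diff a b P N"
    using BV_cdf[OF ab P N, of u "a + \<alpha>"] u_def by auto
  have rep: "AE x in lebesgue. x \<in> {a<..<b} \<longrightarrow> u x = (a + \<alpha>) + signed_cdf P N x"
    by (simp add: u_def)
  have J: "jump_set a b u = (if h2 = 0 then {t1} else {t1, t2})"
    unfolding jump_set_atoms[OF P N rep] Nm using t h by (auto simp: Pm indicator_def)
  have J_sum: "(\<Sum>\<^sub>\<infinity>x\<in>jump_set a b u. ennreal (K \<bar>right_value u x - left_value u x\<bar>)) = ennreal (sat h1 + sat h2)"
  proof -
    have "right_value u x - left_value u x = h1 * indicator {x} t1 + h2 * indicator {x} t2" if "x \<in> {a<..<b}" for x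
      using jump_height[OF P N rep that] Pm[of "{x}"] Nm by simp
    from this[of t1] this[of t2] have "right_value u t1 - left_value u t1 = h1" "right_value u t2 - left_value u t2 = h2"
      using t by auto
    then show ?thesis unfolding J using t h K sat_nonneg by (auto simp: infsum_finite)
  qed
  have var: "variation (signed_diff a b P N) ({a<..<b} - jump_set a b u) = 0"
  proof -
    have "(\<Sum>B\<in>Q. ennreal \<bar>signed_diff a b P N B\<bar>) = 0"
      if Q: "partition_on ({a<..<b} - jump_set a b u) Q" "Q \<subseteq> sets borel" for Q
    proof (rule sum.neutral, rule ballI)
      fix B assume B: "B \<in> Q"
      then have "B \<subseteq> {a<..<b} - jump_set a b u" using partition_onD1[OF Q(1)] by blast
      moreover have "B \<in> sets borel" using Q(2) B by blast
      \<comment> \<open>The block avoids the jump set, which contains every point of positive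
        mass.\<close>
      ultimately have "measure P B = 0" using Pm[of B] J by (auto simp: indicator_def split: if_splits)
      then show "ennreal \<bar>signed_diff a b P N B\<bar> = 0" by (simp add: signed_diff_def Nm)
    qed
    then have "variation (signed_diff a b P N) ({a<..<b} - jump_set a b u) \<le> 0"
      unfolding variation_def by (intro SUP_least) auto
    then show ?thesis by simp
  qed
  define r where "r = (h1 ^ 3 + h2 ^ 3 + (b - a - h1 - h2) ^ 3) / 12"
  have r0: "0 \<le> r" using h unfolding r_def by (intro divide_nonneg_nonneg add_nonneg_nonneg zero_le_power) auto
  have fid: "(\<integral>\<^sup>+x\<in>{a<..<b}. ennreal (\<bar>u x - g x\<bar>\<^sup>2) \<partial>lebesgue) = ennreal r"
  proof -
    have "((\<lambda>x. (u x - x)\<^sup>2) has_integral ((t1 - (a + \<alpha>)) ^ 3 - (a - (a + \<alpha>)) ^ 3) / 3) {a..t1}"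
      using t u by (intro has_integral_square_dist) auto
    moreover have "((\<lambda>x. (u x - x)\<^sup>2) has_integral ((t2 - (a + \<alpha> + h1)) ^ 3 - (t1 - (a + \<alpha> + h1)) ^ 3) / 3) {t1..t2}"
      using t u by (intro has_integral_square_dist) auto
    moreover have "((\<lambda>x. (u x - x)\<^sup>2) has_integral ((b - (a + \<alpha> + h1 + h2)) ^ 3 - (t2 - (a + \<alpha> + h1 + h2)) ^ 3) / 3) {t2..b}"
      using t u by (intro has_integral_square_dist) auto
    ultimately have "((\<lambda>x. (u x - x)\<^sup>2) has_integral
        (((t1 - (a + \<alpha>)) ^ 3 - (a - (a + \<alpha>)) ^ 3) / 3 + ((t2 - (a + \<alpha> + h1)) ^ 3 - (t1 - (a + \<alpha> + h1)) ^ 3) / 3)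
        + ((b - (a + \<alpha> + h1 + h2)) ^ 3 - (t2 - (a + \<alpha> + h1 + h2)) ^ 3) / 3) {a..b}"
      using t by (intro has_integral_combine[of a t2 b] has_integral_combine[of a t1 t2]) auto
    moreover have "(((t1 - (a + \<alpha>)) ^ 3 - (a - (a + \<alpha>)) ^ 3) / 3 + ((t2 - (a + \<alpha> + h1)) ^ 3 - (t1 - (a + \<alpha> + h1)) ^ 3) / 3)
        + ((b - (a + \<alpha> + h1 + h2)) ^ 3 - (t2 - (a + \<alpha> + h1 + h2)) ^ 3) / 3 = r"
    proof -
      have eqs: "t1 - (a + \<alpha>) = h1 / 2" "a - (a + \<alpha>) = - \<alpha>" "t2 - (a + \<alpha> + h1) = h2 / 2"
        "t1 - (a + \<alpha> + h1) = - (h1 / 2)" "b - (a + \<alpha> + h1 + h2) = \<alpha>" "t2 - (a + \<alpha> + h1 + h2) = - (h2 / 2)"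
        by (auto simp: t1_def t2_def \<alpha>_def field_simps)
      have al: "(b - a - h1 - h2) ^ 3 = 8 * \<alpha> ^ 3" by (simp add: \<alpha>_def power_divide)
      show ?thesis unfolding r_def eqs al by (simp add: power_divide field_simps)
    qed
    ultimately have "((\<lambda>x. (u x - x)\<^sup>2) has_integral r) {a..b}" by simp
    then have "((\<lambda>x. (u x - x)\<^sup>2) has_integral r) {a<..<b}" using has_integral_open_interval[of _ r a b] by (simp add: box_real)
    then have "(\<integral>\<^sup>+x. ennreal ((u x - x)\<^sup>2) * indicator {a<..<b} x \<partial>lborel) = ennreal r"
      by (rule nn_integral_has_integral_lebesgue'[rotated]) simp
    moreover have "(\<integral>\<^sup>+x\<in>{a<..<b}. ennreal (\<bar>u x - g x\<bar>\<^sup>2) \<partial>lebesgue)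
        = (\<integral>\<^sup>+x. ennreal ((u x - x)\<^sup>2) * indicator {a<..<b} x \<partial>lebesgue)"
      by (intro nn_integral_cong) (auto simp: indicator_def g)
    ultimately show ?thesis by (simp add: nn_integral_completion)
  qed
  have "TV_Kg K g l a b u = ennreal (sat h1 + sat h2) + ennreal (l / 2) * ennreal r"
    unfolding TV_Kg_def TV_K_def BV(2) var J_sum fid by simp
  also have "ennreal (l / 2) * ennreal r = ennreal (l / 2 * r)"
    by (rule ennreal_mult'[symmetric]) (use l in simp)
  also have "ennreal (sat h1 + sat h2) + \<dots> = ennreal (sat h1 + sat h2 + l / 2 * r)"
    using h l r0 by (intro ennreal_plus[symmetric]) (auto simp: sat_nonneg)
  also have "sat h1 + sat h2 + l / 2 * r = energy l (b - a) [h1, h2]"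
    by (simp add: energy_pair r_def)
  finally have "TV_Kg K g l a b u = ennreal (energy l (b - a) [h1, h2])" .
  moreover have "card (jump_set a b u) = (if h2 = 0 then 1 else 2)" using J t by simp
  moreover have "piecewise_constant a b u"
    unfolding piecewise_constant_def
  proof (intro exI conjI allI impI)
    \<comment> \<open>Three pieces in either case: for h2 = 0 the break at t2 separates two pieces
      with the same value.\<close>
    let ?t = "\<lambda>i::nat. if i = 0 then a else if i = 1 then t1 else if i = 2 then t2 else b"
    show "?t 0 = a" "?t 3 = b" by auto
    fix i :: nat assume "i < 3"
    then consider "i = 0" | "i = 1" | "i = 2" by linarith
    then show "?t i < ?t (Suc i)" "u constant_on {?t i<..<?t (Suc i)}"
      using t u by (cases; force simp: constant_on_def)+
  qed
  ultimately show thesis using that BV(1) by blast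
qed

section \<open>The two minimizers\<close>

theorem corollary1p7:
  fixes a b :: real and K g :: "real \<Rightarrow> real"
  assumes "a < b"
    and "\<And>\<rho>. \<rho> \<ge> 0 \<Longrightarrow> K \<rho> = \<rho> / (1 + \<rho>)"
    and "\<And>x. x \<in> {a<..<b} \<Longrightarrow> g x = x"
  shows "\<exists>lam>0. \<exists>u v.
      is_arg_min (TV_Kg K g lam a b) (\<lambda>w. w \<in> BV a b) u
        \<and> piecewise_constant a b u \<and> card (jump_set a b u) = 1
    \<and> is_arg_min (TV_Kg K g lam a b) (\<lambda>w. w \<in> BV a b) v
        \<and> piecewise_constant a b v \<and> card (jump_set a b v) = 2"
proof -
  note ab = assms(1) and g = assms(3)
  have K: "K \<rho> = sat \<rho>" if "0 \<le> \<rho>" for \<rho> using assms(2)[OF that] by (simp add: sat_def)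
  obtain l h x y where l: "0 < l" and h: "0 < h" "h < b - a" and xy: "0 < x" "0 < y" "x + y \<le> b - a"
    and eq: "energy l (b - a) [x, y] = energy l (b - a) [h]"
    and min: "\<And>hs. \<forall>z\<in>set hs. 0 \<le> z \<Longrightarrow> sum_list hs \<le> b - a \<Longrightarrow> energy l (b - a) [h] \<le> energy l (b - a) hs"
    by (rule critical_parameter[of "b - a"]) (use ab in simp, rule that)
  have lower: "ennreal (energy l (b - a) [h]) \<le> TV_Kg K g l a b w" if "w \<in> BV a b" for w
    by (rule TV_Kg_ge[OF ab that l K g min])
  have arg_min: "is_arg_min (TV_Kg K g l a b) (\<lambda>w. w \<in> BV a b) u"
    if "u \<in> BV a b" "TV_Kg K g l a b u = ennreal (energy l (b - a) [h])" for u
    using lower that unfolding is_arg_min_def by (auto simp: not_less)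
  \<comment> \<open>A second gap 0 leaves the energy of [h] unchanged and produces no second jump,
    so one construction yields both minimizers.\<close>
  obtain u where u: "u \<in> BV a b" "piecewise_constant a b u" "card (jump_set a b u) = (if (0::real) = 0 then 1 else 2)"
    "TV_Kg K g l a b u = ennreal (energy l (b - a) [h, 0])"
    by (rule step_function[of a b h 0 l K g]) (use ab h l K g in auto)
  obtain v where v: "v \<in> BV a b" "piecewise_constant a b v" "card (jump_set a b v) = (if y = 0 then 1 else 2)"
    "TV_Kg K g l a b v = ennreal (energy l (b - a) [x, y])"
    by (rule step_function[of a b x y l K g]) (use ab xy l K g in auto)
  have "energy l (b - a) [h, 0] = energy l (b - a) [h]" by (simp add: energy_def)
  then have "is_arg_min (TV_Kg K g l a b) (\<lambda>w. w \<in> BV a b) u" "card (jump_set a b u) = 1"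
    "is_arg_min (TV_Kg K g l a b) (\<lambda>w. w \<in> BV a b) v" "card (jump_set a b v) = 2"
    using arg_min u v eq xy by auto
  with l u(2) v(2) show ?thesis by blast
qed

end
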